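(* Let $X$ and $Y(\mathbf{x})$ ($\mathbf{x}\in X$) be non-empty and bounded, let $S=\{\mathbf{c}\in\mathbb{R}^n:\mathbf{B}\mathbf{c}\le\mathbf{b}\}$ be non-empty and compact, let the leader's and the follower's data sets be i.i.d. samples from $\mathbb{Q}^*$ with the follower's data set contained in the leader's ($k_f\le k_l$ and $\hat{\mathbf{c}}_f^{(k)}=\hat{\mathbf{c}}_l^{(k)}$ for $k\in K_f$), and let the ambiguity sets $\mathcal{Q}_l,\mathcal{Q}_f$ be defined in terms of the $p$-norm with $p\in\{1,\infty\}$. Let $q$ satisfy $\frac1p+\frac1q=1$, and put $\boldsymbol{\Delta}_i^{(k)}=\mathbf{b}-\mathbf{B}\hat{\mathbf{c}}_i^{(k)}\ge\mathbf{0}$ for $i\in\{l,f\}$, $k\in K_i$. Then the basic distributionally robust interdiction problem $$[\mathbf{DRI}]:\quad \hat z_b^*:=\min_{\mathbf{x},\mathbf{y}}\ \max_{\mathbb{Q}_l\in\mathcal{Q}_l}\rho_l(\mathbf{y},\mathbb{Q}_l)\quad\text{s.t. }\mathbf{x}\in X,\ \ \mathbf{y}\in\arg\max_{\tilde{\mathbf{y}}\in Y(\mathbf{x})}\ \min_{\mathbb{Q}_f\in\mathcal{Q}_f}\rho_f(\tilde{\mathbf{y}},\mathbb{Q}_f)$$ admits the following single-level reformulation: $$\hat z_b^*=\min\ \Big\{t_l+\frac{1}{1-\alpha_l}\Big(\varepsilon_l\lambda_l+\frac1{k_l}\sum_{k\in K_l}s_l^{(k)}\Big)\Big\}$$ where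 the minimum is over $\mathbf{x},\mathbf{y}$, $\boldsymbol{\nu}_l^{(k)},s_l^{(k)}$ ($k\in K_l$), $\lambda_l,t_l$, $\boldsymbol{\nu}_f^{(k)},s_f^{(k)},\overline{\boldsymbol{\mu}}_f^{(k)},\underline{\boldsymbol{\mu}}_f^{(k)},\gamma_f^{(k)}$ ($k\in K_f$), $\lambda_f,t_f,\boldsymbol{\beta}_f$, subject to (leader) $\mathbf{x}\in X$, and for all $k\in K_l$: $\hat{\mathbf{c}}_l^{(k)\top}\mathbf{y}-t_l+\boldsymbol{\Delta}_l^{(k)\top}\boldsymbol{\nu}_l^{(k)}\le s_l^{(k)}$, $\ \|\mathbf{B}^\top\boldsymbol{\nu}_l^{(k)}-\mathbf{y}\|_q\le\lambda_l$, $\ \boldsymbol{\nu}_l^{(k)}\ge\mathbf{0}$, $s_l^{(k)}\ge0$; (follower, primal) $\mathbf{F}\mathbf{y}\le\mathbf{f}-\mathbf{L}\mathbf{x}$, $\mathbf{y}\ge\mathbf{0}$, $\lambda_f\ge0$, and for all $k\in K_f$: $-\hat{\mathbf{c}}_f^{(k)\top}\mathbf{y}+t_f+\boldsymbol{\Delta}_f^{(k)\top}\boldsymbol{\nu}_f^{(k)}\le s_f^{(k)}$, $\ \|\mathbf{B}^\top\boldsymbol{\nu}_f^{(k)}+\mathbf{y}\|_q\le\lambda_f$, $\ \boldsymbol{\nu}_f^{(k)}\ge\mathbf{0}$, $s_f^{(k)}\ge0$; (follower, dual) $\mathbf{F}^\top\boldsymbol{\beta}_f-\sum_{k\in K_f}\gamma_f^{(k)}\hat{\mathbf{c}}_f^{(k)}+\sum_{k\in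 K_f}(\overline{\boldsymbol{\mu}}_f^{(k)}-\underline{\boldsymbol{\mu}}_f^{(k)})\ge\mathbf{0}$; for all $k\in K_f$: $\gamma_f^{(k)}\boldsymbol{\Delta}_f^{(k)}+\mathbf{B}(\overline{\boldsymbol{\mu}}_f^{(k)}-\underline{\boldsymbol{\mu}}_f^{(k)})\ge\mathbf{0}$, $0\le\gamma_f^{(k)}\le\frac{1}{(1-\alpha_f)k_f}$, $\overline{\boldsymbol{\mu}}_f^{(k)}\ge\mathbf{0}$, $\underline{\boldsymbol{\mu}}_f^{(k)}\ge\mathbf{0}$; $\big\|\sum_{k\in K_f}(\overline{\boldsymbol{\mu}}_f^{(k)}+\underline{\boldsymbol{\mu}}_f^{(k)})\big\|_p\le\frac{1}{1-\alpha_f}\varepsilon_f$; $\sum_{k\in K_f}\gamma_f^{(k)}=1$; $\boldsymbol{\beta}_f\ge\mathbf{0}$; (strong duality) $(-\mathbf{L}\mathbf{x}+\mathbf{f})^\top\boldsymbol{\beta}_f=t_f-\frac{1}{1-\alpha_f}\big(\varepsilon_f\lambda_f+\frac1{k_f}\sum_{k\in K_f}s_f^{(k)}\big)$.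
   Context: Feasible sets: $X=\{\mathbf{x}\in\{0,1\}^m:\mathbf{H}\mathbf{x}\le\mathbf{h}\}$ (leader) and $Y(\mathbf{x})=\{\mathbf{y}\in\mathbb{R}^n_+:\mathbf{F}\mathbf{y}+\mathbf{L}\mathbf{x}\le\mathbf{f}\}$ (follower). $S$ is the known support of an unknown true distribution $\mathbb{Q}^*$ of the profit vector $\mathbf{c}$; $\mathcal{Q}_0(S)$ is the set of all probability distributions on $S$. Data: $\hat{\mathbf{C}}_i=\{\hat{\mathbf{c}}_i^{(k)}\in S: k\in K_i=\{1,\dots,k_i\}\}$ for $i=l$ (leader) and $i=f$ (follower), with empirical distributions $\hat{\mathbb{Q}}_i=\frac1{k_i}\sum_{k\in K_i}\delta(\hat{\mathbf{c}}_i^{(k)})$ ($\delta$ = Dirac mass). Ambiguity sets: $\mathcal{Q}_i=\{\mathbb{Q}\in\mathcal{Q}_0(S):W^p(\hat{\mathbb{Q}}_i,\mathbb{Q})\le\varepsilon_i\}$ with radius $\varepsilon_i\in\mathbb{R}_+$, where $W^p$ is the type-1 Wasserstein distance with ground metric the $\ell_p$-norm: $W^p(\hat{\mathbb{Q}}_i,\mathbb{Q})=\inf_{\pi}\int_{S\times S}\|\hat{\mathbf{c}}-\mathbf{c}\|_p\,\pi(\mathrm{d}\hat{\mathbf{c}},\mathrm{d}\mathbf{c})$ over couplings $\pi$ of $\hat{\mathbb{Q}}_i$ and $\mathbb{Q}$. Risk functions, with confidence levels $\alpha_l,\alpha_f\in(0,1)$, $a^+=\max\{a,0\}$, $a^-=\min\{a,0\}$: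 $\rho_l(\mathbf{y},\mathbb{Q})=\min_{t\in\mathbb{R}}\{t+\frac1{1-\alpha_l}\mathbb{E}_{\mathbb{Q}}[(\mathbf{c}^\top\mathbf{y}-t)^+]\}$ and $\rho_f(\mathbf{y},\mathbb{Q})=\max_{t\in\mathbb{R}}\{t+\frac1{1-\alpha_f}\mathbb{E}_{\mathbb{Q}}[(\mathbf{c}^\top\mathbf{y}-t)^-]\}$.
   Formalization: In the follower's dual, the bound on the p-norm of the sum over k of the upper plus lower multipliers is replaced by a bound on the sum of their p-norms; the two agree for p=1, but for p=∞ with k_f≥2 the original constraint is too weak and the claim is false. *)

theory Defs
  imports "HOL-Probability.Probability"
begin

text \<open>
  Vectors are ordered componentwise (the library order on \<open>real ^ 'n\<close>). Data sets and other
  families over \<open>{1..k}\<close> are functions on \<open>nat\<close>; values outside that range are irrelevant.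
\<close>

definition lp_norm :: "ennreal \<Rightarrow> real ^ 'n \<Rightarrow> real" where
  "lp_norm p x =
     (if p = \<infinity> then infnorm x
      else (\<Sum>i\<in>UNIV. \<bar>x $ i\<bar> powr enn2real p) powr (1 / enn2real p))"

definition is_minimum :: "real set \<Rightarrow> real \<Rightarrow> bool" where
  "is_minimum V z \<longleftrightarrow> z \<in> V \<and> (\<forall>v\<in>V. z \<le> v)"

definition leader_set :: "real ^ 'm ^ 'h \<Rightarrow> real ^ 'h \<Rightarrow> (real ^ 'm) set" where
  "leader_set H h = {x. (\<forall>i. x $ i \<in> {0, 1}) \<and> H *v x \<le> h}"

definition follower_set ::
  "real ^ 'n ^ 'f \<Rightarrow> real ^ 'm ^ 'f \<Rightarrow> real ^ 'f \<Rightarrow> real ^ 'm \<Rightarrow> (real ^ 'n) set" where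
  "follower_set F L f x = {y. 0 \<le> y \<and> F *v y + L *v x \<le> f}"

definition support_set :: "real ^ 'n ^ 'b \<Rightarrow> real ^ 'b \<Rightarrow> (real ^ 'n) set" where
  "support_set B b = {c. B *v c \<le> b}"

text \<open>A distribution on \<open>S\<close> is a Borel probability measure on the whole space with \<open>Q(S) = 1\<close>.\<close>

definition distributions_on :: "(real ^ 'n) set \<Rightarrow> (real ^ 'n) measure set" where
  "distributions_on S = {Q. sets Q = sets borel \<and> prob_space Q \<and> emeasure Q S = 1}"

definition iid_sample ::
  "'w measure \<Rightarrow> (real ^ 'n) measure \<Rightarrow> nat \<Rightarrow> (nat \<Rightarrow> 'w \<Rightarrow> real ^ 'n) \<Rightarrow> bool" where
  "iid_sample M Q k C \<longleftrightarrow>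
     prob_space M \<and> prob_space.indep_vars M (\<lambda>_. borel) C {1..k} \<and>
     (\<forall>j\<in>{1..k}. distr M borel (C j) = Q)"

definition empirical :: "nat \<Rightarrow> (nat \<Rightarrow> real ^ 'n) \<Rightarrow> (real ^ 'n) measure" where
  "empirical k c =
     measure_of UNIV (sets borel)
       (\<lambda>A. ennreal (1 / real k) * (\<Sum>j\<in>{1..k}. emeasure (return borel (c j)) A))"

definition couplings ::
  "(real ^ 'n) measure \<Rightarrow> (real ^ 'n) measure \<Rightarrow> ((real ^ 'n) \<times> (real ^ 'n)) measure set" where
  "couplings P Q =
     {\<pi>. sets \<pi> = sets (borel \<Otimes>\<^sub>M borel) \<and> prob_space \<pi> \<and>
         distr \<pi> borel fst = P \<and> distr \<pi> borel snd = Q}"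

text \<open>
  For distributions on \<open>S\<close> every coupling is concentrated on \<open>S \<times> S\<close>, so the domain of
  integration need not be restricted.
\<close>

definition wasserstein ::
  "ennreal \<Rightarrow> (real ^ 'n) measure \<Rightarrow> (real ^ 'n) measure \<Rightarrow> ennreal" where
  "wasserstein p P Q =
     (\<Sqinter>\<pi>\<in>couplings P Q. \<integral>\<^sup>+ z. ennreal (lp_norm p (fst z - snd z)) \<partial>\<pi>)"

definition ambiguity_set ::
  "ennreal \<Rightarrow> (real ^ 'n) set \<Rightarrow> (real ^ 'n) measure \<Rightarrow> real \<Rightarrow> (real ^ 'n) measure set" where
  "ambiguity_set p S P \<epsilon> = {Q \<in> distributions_on S. wasserstein p P Q \<le> ennreal \<epsilon>}"

text \<open>
  The minimum over \<open>t\<close> and the worst cases over an ambiguity set are written as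
  \<open>INF\<close> and \<open>SUP\<close>; for \<open>0 < \<alpha> < 1\<close> and nonempty compact polyhedral \<open>S\<close> they are attained.
\<close>

definition risk_leader :: "real \<Rightarrow> real ^ 'n \<Rightarrow> (real ^ 'n) measure \<Rightarrow> real" where
  "risk_leader \<alpha> y Q = (INF t. t + 1 / (1 - \<alpha>) * (\<integral>c. max (c \<bullet> y - t) 0 \<partial>Q))"

definition risk_follower :: "real \<Rightarrow> real ^ 'n \<Rightarrow> (real ^ 'n) measure \<Rightarrow> real" where
  "risk_follower \<alpha> y Q = (SUP t. t + 1 / (1 - \<alpha>) * (\<integral>c. min (c \<bullet> y - t) 0 \<partial>Q))"

definition worst_leader :: "real \<Rightarrow> (real ^ 'n) measure set \<Rightarrow> real ^ 'n \<Rightarrow> real" where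
  "worst_leader \<alpha> \<Q> y = (SUP Q\<in>\<Q>. risk_leader \<alpha> y Q)"

definition worst_follower :: "real \<Rightarrow> (real ^ 'n) measure set \<Rightarrow> real ^ 'n \<Rightarrow> real" where
  "worst_follower \<alpha> \<Q> y = (INF Q\<in>\<Q>. risk_follower \<alpha> y Q)"

definition DRI_values ::
  "(real ^ 'm) set \<Rightarrow> (real ^ 'm \<Rightarrow> (real ^ 'n) set) \<Rightarrow> real \<Rightarrow> (real ^ 'n) measure set \<Rightarrow>
   real \<Rightarrow> (real ^ 'n) measure set \<Rightarrow> real set" where
  "DRI_values X Y \<alpha>\<^sub>l \<Q>\<^sub>l \<alpha>\<^sub>f \<Q>\<^sub>f =
     {worst_leader \<alpha>\<^sub>l \<Q>\<^sub>l y | x y.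
        x \<in> X \<and> is_arg_max (worst_follower \<alpha>\<^sub>f \<Q>\<^sub>f) (\<lambda>y'. y' \<in> Y x) y}"

definition slack :: "real ^ 'n ^ 'b \<Rightarrow> real ^ 'b \<Rightarrow> real ^ 'n \<Rightarrow> real ^ 'b" where
  "slack B b c = b - B *v c"

definition leader_constraints ::
  "ennreal \<Rightarrow> real ^ 'n ^ 'b \<Rightarrow> real ^ 'b \<Rightarrow> nat \<Rightarrow> (nat \<Rightarrow> real ^ 'n) \<Rightarrow> real ^ 'n \<Rightarrow>
   (nat \<Rightarrow> real ^ 'b) \<Rightarrow> (nat \<Rightarrow> real) \<Rightarrow> real \<Rightarrow> real \<Rightarrow> bool" where
  "leader_constraints q B b k c y \<nu> s lam t \<longleftrightarrow>
     (\<forall>j\<in>{1..k}.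
        c j \<bullet> y - t + slack B b (c j) \<bullet> \<nu> j \<le> s j \<and>
        lp_norm q (transpose B *v \<nu> j - y) \<le> lam \<and>
        0 \<le> \<nu> j \<and> 0 \<le> s j)"

definition follower_primal_constraints ::
  "ennreal \<Rightarrow> real ^ 'n ^ 'b \<Rightarrow> real ^ 'b \<Rightarrow> real ^ 'n ^ 'f \<Rightarrow> real ^ 'm ^ 'f \<Rightarrow> real ^ 'f \<Rightarrow>
   nat \<Rightarrow> (nat \<Rightarrow> real ^ 'n) \<Rightarrow> real ^ 'm \<Rightarrow> real ^ 'n \<Rightarrow>
   (nat \<Rightarrow> real ^ 'b) \<Rightarrow> (nat \<Rightarrow> real) \<Rightarrow> real \<Rightarrow> real \<Rightarrow> bool" where
  "follower_primal_constraints q B b F L f k c x y \<nu> s lam t \<longleftrightarrow>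
     F *v y \<le> f - L *v x \<and> 0 \<le> y \<and> 0 \<le> lam \<and>
     (\<forall>j\<in>{1..k}.
        - (c j \<bullet> y) + t + slack B b (c j) \<bullet> \<nu> j \<le> s j \<and>
        lp_norm q (transpose B *v \<nu> j + y) \<le> lam \<and>
        0 \<le> \<nu> j \<and> 0 \<le> s j)"

text \<open>
  The radius constraint below is the dual counterpart of \<open>lam\<close>, which bounds \<open>k\<close> separate
  \<open>q\<close>-norms in the primal; hence it bounds a sum of \<open>k\<close> \<open>p\<close>-norms. For \<open>p = 1\<close> this is the
  \<open>1\<close>-norm of the summed multipliers (lemma \<open>lp_norm_one_sum\<close>). For \<open>p = \<infinity>\<close> and \<open>k \<ge> 2\<close> the
  norm of the sum would be a strictly weaker constraint, for which weak duality fails, so that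
  the strong duality equation would no longer force \<open>y\<close> to be optimal for the follower.
\<close>

definition follower_dual_constraints ::
  "ennreal \<Rightarrow> real ^ 'n ^ 'b \<Rightarrow> real ^ 'b \<Rightarrow> real ^ 'n ^ 'f \<Rightarrow> real \<Rightarrow> real \<Rightarrow>
   nat \<Rightarrow> (nat \<Rightarrow> real ^ 'n) \<Rightarrow>
   (nat \<Rightarrow> real ^ 'n) \<Rightarrow> (nat \<Rightarrow> real ^ 'n) \<Rightarrow> (nat \<Rightarrow> real) \<Rightarrow> real ^ 'f \<Rightarrow> bool" where
  "follower_dual_constraints p B b F \<alpha> \<epsilon> k c \<mu>u \<mu>d \<gamma> \<beta> \<longleftrightarrow>
     0 \<le> transpose F *v \<beta> - (\<Sum>j\<in>{1..k}. \<gamma> j *\<^sub>R c j) + (\<Sum>j\<in>{1..k}. \<mu>u j - \<mu>d j) \<and>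
     (\<forall>j\<in>{1..k}.
        0 \<le> \<gamma> j *\<^sub>R slack B b (c j) + B *v (\<mu>u j - \<mu>d j) \<and>
        0 \<le> \<gamma> j \<and> \<gamma> j \<le> 1 / ((1 - \<alpha>) * real k) \<and>
        0 \<le> \<mu>u j \<and> 0 \<le> \<mu>d j) \<and>
     (\<Sum>j\<in>{1..k}. lp_norm p (\<mu>u j + \<mu>d j)) \<le> 1 / (1 - \<alpha>) * \<epsilon> \<and>
     (\<Sum>j\<in>{1..k}. \<gamma> j) = 1 \<and>
     0 \<le> \<beta>"

lemma lp_norm_one: "lp_norm 1 x = (\<Sum>i\<in>UNIV. \<bar>x $ i\<bar>)"
  by (simp add: lp_norm_def sum_nonneg)

lemma lp_norm_one_sum:
  assumes "\<And>j. j \<in> J \<Longrightarrow> 0 \<le> v j"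
  shows "lp_norm 1 (\<Sum>j\<in>J. v j) = (\<Sum>j\<in>J. lp_norm 1 (v j))"
proof -
  have nn: "0 \<le> v j $ i" if "j \<in> J" for i j
    using assms[OF that] by (simp add: less_eq_vec_def)
  have "lp_norm 1 (\<Sum>j\<in>J. v j) = (\<Sum>i\<in>UNIV. \<Sum>j\<in>J. v j $ i)"
    by (simp add: lp_norm_one sum_nonneg nn)
  also have "\<dots> = (\<Sum>j\<in>J. \<Sum>i\<in>UNIV. v j $ i)"
    by (rule sum.swap)
  also have "\<dots> = (\<Sum>j\<in>J. lp_norm 1 (v j))"
    by (intro sum.cong refl) (simp add: lp_norm_one nn)
  finally show ?thesis .
qed

lemma sets_empirical [simp, measurable_cong]: "sets (empirical k c) = sets borel"
  by (simp add: empirical_def sets.sigma_sets_eq[of borel, simplified])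

lemma emeasure_empirical:
  assumes "A \<in> sets borel"
  shows "emeasure (empirical k c) A =
           ennreal (1 / real k) * (\<Sum>j\<in>{1..k}. emeasure (return borel (c j)) A)"
  unfolding empirical_def
proof (rule emeasure_measure_of_sigma)
  show "sigma_algebra UNIV (sets (borel :: (real ^ 'a) measure))"
    using sets.sigma_algebra_axioms[of "borel :: (real ^ 'a) measure"] by simp
  show "positive (sets borel)
     (\<lambda>A. ennreal (1 / real k) * (\<Sum>j\<in>{1..k}. emeasure (return borel (c j)) A))"
    by (simp add: positive_def)
  show "countably_additive (sets borel)
     (\<lambda>A. ennreal (1 / real k) * (\<Sum>j\<in>{1..k}. emeasure (return borel (c j)) A))"
  proof (rule countably_additiveI)
    fix A :: "nat \<Rightarrow> (real ^ 'a) set"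
    assume A: "range A \<subseteq> sets borel" "disjoint_family A"
    have *: "(\<Sum>i. emeasure (return borel (c j)) (A i)) = emeasure (return borel (c j)) (\<Union>(range A))" for j
      by (rule suminf_emeasure) (use A in auto)
    show "(\<Sum>i. ennreal (1 / real k) * (\<Sum>j\<in>{1..k}. emeasure (return borel (c j)) (A i))) =
      ennreal (1 / real k) * (\<Sum>j\<in>{1..k}. emeasure (return borel (c j)) (\<Union>(range A)))"
      by (simp only: ennreal_suminf_cmult suminf_sum[OF summableI] *)
  qed
qed (rule assms)

lemma prob_space_empirical:
  assumes "1 \<le> k"
  shows "prob_space (empirical k c)"
proof
  have sp: "space (empirical k c) = UNIV"
    using sets_eq_imp_space_eq[OF sets_empirical[of k c]] by simp
  have "emeasure (empirical k c) UNIV = ennreal (1 / real k) * of_nat k"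
    by (subst emeasure_empirical) simp_all
  also have "\<dots> = 1"
    using assms by (simp add: ennreal_of_nat_eq_real_of_nat flip: ennreal_mult)
  finally show "emeasure (empirical k c) (space (empirical k c)) = 1"
    by (simp add: sp)
qed

end

theory Submission
  imports Defs
begin

text \<open>
  The vertices \<open>e\<close> of the \<open>p\<close>-ball turn \<open>\<parallel>v\<parallel>\<^sub>q \<le> lam\<close> into finitely many linear constraints, so all
  duality is that of finite linear programs. For fixed \<open>y\<close>, integrating the pointwise bound
  \<open>(x \<bullet> y - t)\<^sup>+ \<le> s\<^sub>j + lam \<parallel>x - c\<^sub>j\<parallel>\<^sub>p\<close> along couplings bounds the leader's worst-case risk by the
  value of every feasible point of the leader's system. Conversely, a point of the dual program
  yields a discrete distribution in the ambiguity set whose risk is at least the dual value. So the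
  dual program is bounded by the worst-case risk, and its multipliers form a feasible point that
  attains it; no minimax theorem is needed.

  The follower's worst case is minus the leader's at \<open>-y\<close>. Maximising it over \<open>Y(x)\<close> is again a linear
  program, whose dual is the follower's dual system, so the strong duality equation expresses
  optimality of \<open>y\<close>. Worst-case risks are Lipschitz in \<open>y\<close>, the sets of optimal \<open>y\<close> are compact
  and \<open>X\<close> is finite, hence the minimum is attained.
\<close>

section \<open>Linear programming duality\<close>

text \<open>Induction on the set of constraints. If dropping \<open>m\<close> destroys the
  implication, some \<open>z\<close> meets all other constraints although \<open>c\<close> is
  positive there; projecting along \<open>z\<close> onto the hyperplane where \<open>a m\<close>
  vanishes reduces to the remaining constraints.\<close>

lemma farkas:
  fixes a :: "'j \<Rightarrow> 'i \<Rightarrow> real" and c :: "'i \<Rightarrow> real"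
  assumes "finite J" "finite I"
    and "\<And>x. (\<And>j. j \<in> J \<Longrightarrow> (\<Sum>i\<in>I. a j i * x i) \<le> 0) \<Longrightarrow> (\<Sum>i\<in>I. c i * x i) \<le> 0"
  shows "\<exists>y. (\<forall>j\<in>J. 0 \<le> y j) \<and> (\<forall>i\<in>I. c i = (\<Sum>j\<in>J. y j * a j i))"
  using assms(1,3)
proof (induction J arbitrary: a c rule: finite_induct)
  case empty
  have "(\<Sum>i\<in>I. c i * c i) \<le> 0"
    by (rule empty.prems) simp
  then have "\<forall>i\<in>I. c i * c i = 0"
    using sum_nonneg_eq_0_iff[OF assms(2), of "\<lambda>i. c i * c i"]
    by (metis (mono_tags, lifting) dual_order.antisym sum_nonneg zero_le_square)
  then show ?case by auto
next
  case (insert m J)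
  define dot where "dot u x = (\<Sum>i\<in>I. u i * x i)" for u x :: "'i \<Rightarrow> real"
  have dot_diff: "dot u (\<lambda>i. x i - r * z i) = dot u x - r * dot u z"
    "dot (\<lambda>i. u i - r * v i) x = dot u x - r * dot v x" for u v x z r
    by (simp_all add: dot_def algebra_simps sum_subtractf sum_distrib_left)
  have prems: "dot c x \<le> 0" if "dot (a m) x \<le> 0" "\<And>j. j \<in> J \<Longrightarrow> dot (a j) x \<le> 0" for x
    unfolding dot_def by (rule insert.prems) (use that in \<open>auto simp: dot_def\<close>)
  show ?case
  proof (cases "\<forall>x. (\<forall>j\<in>J. dot (a j) x \<le> 0) \<longrightarrow> dot c x \<le> 0")
    case True
    then obtain y where y: "\<forall>j\<in>J. 0 \<le> y j" "\<forall>i\<in>I. c i = (\<Sum>j\<in>J. y j * a j i)"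
      using insert.IH[of a c] unfolding dot_def by blast
    have "(\<Sum>j\<in>J. (y(m := 0)) j * a j i) = (\<Sum>j\<in>J. y j * a j i)" for i
      by (rule sum.cong) (use insert.hyps in auto)
    with y insert.hyps show ?thesis
      by (intro exI[of _ "y(m := 0)"]) auto
  next
    case False
    then obtain z where z: "\<And>j. j \<in> J \<Longrightarrow> dot (a j) z \<le> 0" "0 < dot c z"
      by force
    with prems[of z] have amz: "0 < dot (a m) z" by force
    \<comment> \<open>\<open>x0\<close> is \<open>z\<close> scaled so that \<open>a m\<close> takes
      the value 1 there.\<close>
    define x0 where "x0 i = z i / dot (a m) z" for i
    have x0: "dot u x0 = dot u z / dot (a m) z" for u
      by (simp add: dot_def x0_def sum_divide_distrib)
    \<comment> \<open>\<open>c'\<close> and \<open>a' j\<close> are \<open>c\<close> and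
      \<open>a j\<close> composed with the projection that sends \<open>x\<close> to
      \<open>x - dot (a m) x * x0\<close>.\<close>
    define c' where "c' i = c i - dot c x0 * a m i" for i
    define a' where "a' j i = a j i - dot (a j) x0 * a m i" for j i
    have "dot c' x \<le> 0" if x: "\<And>j. j \<in> J \<Longrightarrow> dot (a' j) x \<le> 0" for x
    proof -
      define x' where "x' i = x i - dot (a m) x * x0 i" for i
      have x': "dot u x' = dot u x - dot (a m) x * dot u x0" for u
        unfolding x'_def by (rule dot_diff)
      have "dot c x' \<le> 0"
      proof (rule prems)
        show "dot (a m) x' \<le> 0" using amz by (simp add: x' x0)
        show "dot (a j) x' \<le> 0" if "j \<in> J" for j
          using x[OF that] unfolding a'_def dot_diff x' by (simp add: mult.commute)
      qed
      then show ?thesis unfolding c'_def dot_diff x' by (simp add: mult.commute)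
    qed
    then obtain y where y: "\<forall>j\<in>J. 0 \<le> y j" "\<forall>i\<in>I. c' i = (\<Sum>j\<in>J. y j * a' j i)"
      using insert.IH[of a' c'] unfolding dot_def by blast
    \<comment> \<open>The coefficient of \<open>a m\<close> once \<open>c'\<close> and
      \<open>a'\<close> are expanded. It is nonnegative because at \<open>x0\<close> the functional
      \<open>c\<close> is nonnegative and every \<open>a j\<close> is nonpositive.\<close>
    define r where "r = dot c x0 - (\<Sum>j\<in>J. y j * dot (a j) x0)"
    have "0 \<le> dot c x0" "\<And>j. j \<in> J \<Longrightarrow> dot (a j) x0 \<le> 0"
      using z amz by (auto simp: x0 divide_le_0_iff)
    with y(1) have "0 \<le> r"
      unfolding r_def by (smt (verit) mult_nonneg_nonpos sum_nonpos)
    have *: "c i = r * a m i + (\<Sum>j\<in>J. y j * a j i)" if "i \<in> I" for i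
      using y(2) that
      by (auto simp: c'_def a'_def r_def algebra_simps sum_subtractf sum_distrib_left)
    have "(\<Sum>j\<in>J. (y(m := r)) j * a j i) = (\<Sum>j\<in>J. y j * a j i)" for i
      by (rule sum.cong) (use insert.hyps in auto)
    with y(1) * \<open>0 \<le> r\<close> insert.hyps show ?thesis
      by (intro exI[of _ "y(m := r)"]) auto
  qed
qed

text \<open>Farkas for the homogenised program: the coordinate \<open>None\<close> scales the
  right-hand side and carries \<open>- d\<close> in the objective. Any upper bound \<open>d\<close>
  may be used, so the optimal value need not be known in advance.\<close>

lemma lp_duality:
  fixes A :: "'j \<Rightarrow> 'i \<Rightarrow> real" and b :: "'j \<Rightarrow> real" and c x0 :: "'i \<Rightarrow> real"
  assumes fin: "finite J" "finite I"
    and feasible: "\<And>i. i \<in> I \<Longrightarrow> 0 \<le> x0 i" "\<And>j. j \<in> J \<Longrightarrow> (\<Sum>i\<in>I. A j i * x0 i) \<le> b j"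
    and bound: "\<And>x. (\<And>i. i \<in> I \<Longrightarrow> 0 \<le> x i) \<Longrightarrow> (\<And>j. j \<in> J \<Longrightarrow> (\<Sum>i\<in>I. A j i * x i) \<le> b j)
      \<Longrightarrow> (\<Sum>i\<in>I. c i * x i) \<le> d"
  shows "\<exists>y. (\<forall>j\<in>J. 0 \<le> y j) \<and> (\<forall>i\<in>I. c i \<le> (\<Sum>j\<in>J. y j * A j i)) \<and> (\<Sum>j\<in>J. y j * b j) \<le> d"
proof -
  define I' where "I' = insert None (Some ` I)"
  define J' where "J' = J <+> I'"
  have fin': "finite I'" "finite J'" using fin by (auto simp: I'_def J'_def)
  have sum_I': "(\<Sum>i\<in>I'. g i) = g None + (\<Sum>i\<in>I. g (Some i))" for g :: "'i option \<Rightarrow> real"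
    using fin by (simp add: I'_def sum.reindex)
  \<comment> \<open>\<open>Inl\<close> rows are the scaled constraints, \<open>Inr\<close> rows the
    sign constraints on all coordinates, \<open>None\<close> included.\<close>
  define a where "a j = (case j of
      Inl j \<Rightarrow> (\<lambda>i. case i of None \<Rightarrow> - b j | Some i \<Rightarrow> A j i)
    | Inr i \<Rightarrow> (\<lambda>i'. if i' = i then -1 else 0))" for j
  define c' where "c' = (\<lambda>i. case i of None \<Rightarrow> - d | Some i \<Rightarrow> c i)"
  have "(\<Sum>i\<in>I'. c' i * x i) \<le> 0" if x: "\<And>j. j \<in> J' \<Longrightarrow> (\<Sum>i\<in>I'. a j i * x i) \<le> 0" for x
  proof -
    define X where "X i = x (Some i)" for i
    have X: "(\<Sum>i\<in>I. A j i * X i) \<le> b j * x None" if "j \<in> J" for j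
      using x[of "Inl j"] that by (auto simp: sum_I' a_def J'_def X_def)
    have nn: "0 \<le> x i" if "i \<in> I'" for i
    proof -
      have "(\<Sum>i'\<in>I'. a (Inr i) i' * x i') = (\<Sum>i'\<in>I'. if i' = i then - x i else 0)"
        by (rule sum.cong) (auto simp: a_def)
      moreover have "Inr i \<in> J'" using that by (auto simp: J'_def)
      ultimately show ?thesis using x[of "Inr i"] that fin' by simp
    qed
    have X0: "0 \<le> X i" if "i \<in> I" for i using nn that by (auto simp: X_def I'_def)
    have "(\<Sum>i\<in>I. c i * X i) \<le> d * x None"
    proof (cases "x None = 0")
      case False
      then have pos: "0 < x None" using nn[of None] by (simp add: I'_def)
      have "(\<Sum>i\<in>I. c i * (X i / x None)) \<le> d"
        by (rule bound) (use pos X0 X in \<open>auto simp: divide_le_eq simp flip: sum_divide_distrib\<close>)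
      with pos show ?thesis by (simp add: divide_le_eq flip: sum_divide_distrib)
    next
      \<comment> \<open>Now \<open>X\<close> is a recession direction: \<open>x0 + r * X\<close>
        stays feasible for every \<open>r \<ge> 0\<close>, so a positive objective along
        \<open>X\<close> would exceed \<open>d\<close>.\<close>
      case True
      have le: "(\<Sum>i\<in>I. c i * x0 i) + r * (\<Sum>i\<in>I. c i * X i) \<le> d" if "0 \<le> r" for r
      proof -
        have "(\<Sum>i\<in>I. c i * (x0 i + r * X i)) \<le> d"
        proof (rule bound)
          fix j assume "j \<in> J"
          then have "(\<Sum>i\<in>I. A j i * x0 i) + r * (\<Sum>i\<in>I. A j i * X i) \<le> b j + r * 0"
            using feasible X[of j] True that by (intro add_mono mult_left_mono) auto
          then show "(\<Sum>i\<in>I. A j i * (x0 i + r * X i)) \<le> b j"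
            by (simp add: algebra_simps sum.distrib sum_distrib_left)
        qed (use feasible X0 that in auto)
        then show ?thesis by (simp add: algebra_simps sum.distrib sum_distrib_left)
      qed
      have "\<not> 0 < (\<Sum>i\<in>I. c i * X i)" (is "\<not> 0 < ?s")
      proof
        assume pos: "0 < ?s"
        define r where "r = (\<bar>d - (\<Sum>i\<in>I. c i * x0 i)\<bar> + 1) / ?s"
        have "0 \<le> r" "r * ?s = \<bar>d - (\<Sum>i\<in>I. c i * x0 i)\<bar> + 1" using pos by (auto simp: r_def)
        with le[of r] show False by linarith
      qed
      then show ?thesis using True by simp
    qed
    then show ?thesis by (simp add: sum_I' c'_def X_def)
  qed
  then obtain y where y: "\<forall>j\<in>J'. 0 \<le> y j" "\<forall>i\<in>I'. c' i = (\<Sum>j\<in>J'. y j * a j i)"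
    using farkas[OF fin'(2,1), of a c'] by blast
  \<comment> \<open>The multipliers of the sign rows are the surplus that turns the equations of
    \<open>farkas\<close> into the desired inequalities.\<close>
  have split: "c' i = (\<Sum>j\<in>J. y (Inl j) * a (Inl j) i) - y (Inr i)" if "i \<in> I'" for i
  proof -
    have "(\<Sum>i'\<in>I'. y (Inr i') * a (Inr i') i) = (\<Sum>i'\<in>I'. if i' = i then - y (Inr i) else 0)"
      by (rule sum.cong) (auto simp: a_def)
    with y(2) that fin' fin show ?thesis by (simp add: J'_def sum.Plus)
  qed
  have nn: "0 \<le> y (Inr i)" if "i \<in> I'" for i
    using y(1) that by (auto simp: J'_def)
  show ?thesis
  proof (intro exI[of _ "\<lambda>j. y (Inl j)"] conjI ballI)
    show "0 \<le> y (Inl j)" if "j \<in> J" for j using y(1) that by (auto simp: J'_def)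
    show "c i \<le> (\<Sum>j\<in>J. y (Inl j) * A j i)" if "i \<in> I" for i
      using split[of "Some i"] nn[of "Some i"] that by (simp add: c'_def a_def I'_def)
    show "(\<Sum>j\<in>J. y (Inl j) * b j) \<le> d"
      using split[of None] nn[of None] by (simp add: c'_def a_def I'_def sum_negf)
  qed
qed

section \<open>The 1-norm and the maximum norm\<close>

lemma lp_norm_infty: "lp_norm \<top> x = infnorm x"
  by (simp add: lp_norm_def)

text \<open>Only the two pairs that occur are listed, so every norm law becomes a check of two
  cases.\<close>

definition conjugate :: "ennreal \<Rightarrow> ennreal \<Rightarrow> bool" where
  "conjugate p q \<longleftrightarrow> (p, q) \<in> {(1, \<infinity>), (\<infinity>, 1)}"

text \<open>Ties the enumeration to the exponent equation; in \<open>ennreal\<close> the infinite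
  exponent has reciprocal 0.\<close>

lemma conjugate_iff:
  assumes "p \<in> {1, \<infinity>}"
  shows "conjugate p q \<longleftrightarrow> 1 / p + 1 / q = 1"
proof (cases "p = 1")
  case True
  have "1 + 1 / q = 1 \<longleftrightarrow> 1 / q = 0"
    using ennreal_add_left_cancel[of 1 "1 / q" 0] by simp
  also have "\<dots> \<longleftrightarrow> q = \<infinity>"
    by (simp add: divide_ennreal_def ennreal_inverse_eq_0_iff)
  finally show ?thesis using True by (auto simp: conjugate_def divide_ennreal_def)
next
  case False
  then have p: "p = \<infinity>" using assms by auto
  have "inverse q = 1 \<longleftrightarrow> q = 1"
  proof (cases q)
    case (real r)
    then show ?thesis by (cases "r = 0") (auto simp: inverse_ennreal)
  qed simp
  with p show ?thesis by (auto simp: conjugate_def divide_ennreal_def)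
qed

section \<open>Norm laws for the exponents 1 and infinity\<close>

lemma lp_norm_triangle: "conjugate p q \<Longrightarrow> lp_norm p (x + y) \<le> lp_norm p x + lp_norm p y"
  by (auto simp: conjugate_def lp_norm_one lp_norm_infty infnorm_triangle
      simp flip: sum.distrib intro!: sum_mono)

lemma lp_norm_scaleR: "conjugate p q \<Longrightarrow> lp_norm p (a *\<^sub>R x) = \<bar>a\<bar> * lp_norm p x"
  by (auto simp: conjugate_def lp_norm_one lp_norm_infty infnorm_mul abs_mult sum_distrib_left)

lemma lp_norm_zero: "conjugate p q \<Longrightarrow> lp_norm p 0 = 0"
  by (auto simp: conjugate_def lp_norm_one lp_norm_infty infnorm_0)

lemma lp_norm_minus: "conjugate p q \<Longrightarrow> lp_norm p (- x) = lp_norm p x"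
  by (auto simp: conjugate_def lp_norm_one lp_norm_infty infnorm_neg)

lemma lp_norm_nonneg: "conjugate p q \<Longrightarrow> 0 \<le> lp_norm p x"
  by (auto simp: conjugate_def lp_norm_one lp_norm_infty infnorm_pos_le sum_nonneg)

lemma lp_norm_sum:
  assumes "conjugate p q"
  shows "lp_norm p (\<Sum>i\<in>I. v i) \<le> (\<Sum>i\<in>I. lp_norm p (v i))"
proof (induction I rule: infinite_finite_induct)
  case (insert i I)
  then show ?case using lp_norm_triangle[OF assms, of "v i" "\<Sum>i\<in>I. v i"] by simp
qed (simp_all add: lp_norm_zero[OF assms])

lemma infnorm_cart_le: "(\<And>i. \<bar>x $ i\<bar> \<le> r) \<Longrightarrow> infnorm (x :: real ^ 'n) \<le> r"
  unfolding infnorm_cart by (rule cSup_least) auto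

text \<open>Serves to compare a vector with the sum of two nonnegative vectors of which it is the
  difference.\<close>

lemma lp_norm_mono:
  assumes "conjugate p q" "\<And>i. \<bar>x $ i\<bar> \<le> \<bar>y $ i\<bar>"
  shows "lp_norm p x \<le> lp_norm p y"
proof -
  have "infnorm x \<le> infnorm y"
    using assms(2) component_le_infnorm_cart[of y] by (intro infnorm_cart_le) (meson order_trans)
  moreover have "(\<Sum>i\<in>UNIV. \<bar>x $ i\<bar>) \<le> (\<Sum>i\<in>UNIV. \<bar>y $ i\<bar>)"
    by (rule sum_mono) (rule assms(2))
  ultimately show ?thesis
    using assms(1) by (auto simp: conjugate_def lp_norm_one lp_norm_infty)
qed

lemma conjugate_sym: "conjugate p q \<Longrightarrow> conjugate q p"
  by (auto simp: conjugate_def)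

lemma lp_norm_hoelder:
  assumes "conjugate p q"
  shows "x \<bullet> y \<le> lp_norm p x * lp_norm q y"
proof -
  have *: "x \<bullet> y \<le> lp_norm 1 x * lp_norm \<top> y" for x y :: "real ^ 'a"
  proof -
    have "x \<bullet> y \<le> (\<Sum>i\<in>UNIV. \<bar>x $ i\<bar> * infnorm y)"
      unfolding inner_vec_def
    proof (rule sum_mono)
      fix i
      have "x $ i \<bullet> y $ i \<le> \<bar>x $ i\<bar> * \<bar>y $ i\<bar>" by (simp flip: abs_mult)
      also have "\<dots> \<le> \<bar>x $ i\<bar> * infnorm y"
        by (intro mult_left_mono component_le_infnorm_cart) simp
      finally show "x $ i \<bullet> y $ i \<le> \<bar>x $ i\<bar> * infnorm y" .
    qed
    then show ?thesis by (simp add: lp_norm_one lp_norm_infty sum_distrib_right)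
  qed
  show ?thesis
    using assms *[of x y] *[of y x] by (auto simp: conjugate_def inner_commute mult.commute)
qed

text \<open>Corners of the cube for \<open>p = \<infinity>\<close>; otherwise those of the
  cross-polytope, the unit ball for \<open>p = 1\<close>.\<close>

definition ball_vertices :: "ennreal \<Rightarrow> (real ^ 'n) set" where
  "ball_vertices p =
     (if p = \<infinity> then {e. \<forall>i. e $ i \<in> {-1, 1}} else (\<lambda>(i, s). axis i s) ` (UNIV \<times> {-1, 1}))"

lemma finite_vec_components: "finite A \<Longrightarrow> finite {x :: 'a ^ 'n. \<forall>i. x $ i \<in> A}"
proof -
  assume "finite A"
  moreover have "{x :: 'a ^ 'n. \<forall>i. x $ i \<in> A} \<subseteq> vec_lambda ` (UNIV \<rightarrow>\<^sub>E A)"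
    by (rule subsetI, rule image_eqI[where x = "vec_nth _"]) auto
  ultimately show ?thesis
    by (meson finite finite_PiE finite_imageI finite_subset)
qed

lemma finite_ball_vertices: "finite (ball_vertices p)"
  unfolding ball_vertices_def by (simp add: finite_vec_components del: insert_iff)

lemma lp_norm_ball_vertex:
  assumes "conjugate p q" "e \<in> ball_vertices p"
  shows "lp_norm p e \<le> 1"
proof -
  consider "p = 1" | "p = \<infinity>" using assms(1) by (auto simp: conjugate_def)
  then show ?thesis
  proof cases
    case 1
    then obtain i s where "e = axis i s" "\<bar>s\<bar> = 1"
      using assms(2) by (auto simp: ball_vertices_def)
    then have "lp_norm p e = (\<Sum>j\<in>UNIV. if j = i then 1 else 0)"
      unfolding 1 lp_norm_one by (intro sum.cong) (auto simp: axis_def)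
    then show ?thesis by simp
  next
    case 2
    then have "\<bar>e $ i\<bar> \<le> 1" for i using assms(2) by (auto simp: ball_vertices_def dest: spec[of _ i])
    then show ?thesis by (simp add: 2 lp_norm_infty infnorm_cart_le)
  qed
qed

text \<open>The dual norm is the maximum of the functionals given by the vertices. One direction is
  Hoelder's inequality. For the other, signed unit vectors read off the single entries of
  \<open>v\<close>, and its sign pattern reads off the sum of their moduli.\<close>

lemma lp_norm_le_iff:
  assumes "conjugate p q"
  shows "lp_norm q v \<le> r \<longleftrightarrow> (\<forall>e\<in>ball_vertices p. e \<bullet> v \<le> r)"
proof
  assume r: "lp_norm q v \<le> r"
  show "\<forall>e\<in>ball_vertices p. e \<bullet> v \<le> r"
  proof
    fix e :: "real ^ 'a" assume "e \<in> ball_vertices p"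
    then have "e \<bullet> v \<le> 1 * lp_norm q v"
      using lp_norm_ball_vertex[OF assms] lp_norm_hoelder[OF assms, of e v]
        lp_norm_nonneg[OF conjugate_sym[OF assms], of v]
      by (meson mult_right_mono order_trans)
    with r show "e \<bullet> v \<le> r" by simp
  qed
next
  assume r: "\<forall>e\<in>ball_vertices p. e \<bullet> v \<le> r"
  consider "p = 1" "q = \<infinity>" | "p = \<infinity>" "q = 1" using assms by (auto simp: conjugate_def)
  then show "lp_norm q v \<le> r"
  proof cases
    case 1
    have "\<bar>v $ i\<bar> \<le> r" for i
    proof -
      have "axis i 1 \<in> ball_vertices p" "axis i (-1) \<in> ball_vertices p"
        using 1 by (auto simp: ball_vertices_def)
      with r have "axis i 1 \<bullet> v \<le> r" "axis i (-1) \<bullet> v \<le> r" by blast+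
      then show ?thesis by (simp add: inner_axis')
    qed
    then show ?thesis by (simp add: 1 lp_norm_infty infnorm_cart_le)
  next
    case 2
    define e :: "real ^ 'a" where "e = (\<chi> i. if v $ i < 0 then -1 else 1)"
    have "e \<in> ball_vertices p" using 2 by (simp add: ball_vertices_def e_def)
    moreover have "e \<bullet> v = lp_norm 1 v"
      unfolding lp_norm_one inner_vec_def by (rule sum.cong) (auto simp: e_def)
    ultimately show ?thesis using r 2 by auto
  qed
qed

text \<open>Cauchy-Schwarz for each of the finitely many vertex functionals.\<close>

lemma lp_norm_le_norm:
  assumes "conjugate p q"
  shows "\<exists>K\<ge>0. \<forall>v :: real ^ 'n. lp_norm q v \<le> K * norm v"
proof -
  define K where "K = (\<Sum>e\<in>(ball_vertices p :: (real ^ 'n) set). norm e)"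
  have "e \<bullet> v \<le> K * norm v" if "e \<in> ball_vertices p" for e v :: "real ^ 'n"
  proof -
    have "norm e \<le> K"
      unfolding K_def using that by (intro member_le_sum) (auto simp: finite_ball_vertices)
    then have "norm e * norm v \<le> K * norm v" by (intro mult_right_mono) auto
    with norm_cauchy_schwarz[of e v] show ?thesis by linarith
  qed
  then have "\<forall>v :: real ^ 'n. lp_norm q v \<le> K * norm v" by (simp add: lp_norm_le_iff[OF assms])
  moreover have "0 \<le> K" by (simp add: K_def sum_nonneg)
  ultimately show ?thesis by blast
qed

lemma borel_measurable_lp_norm [measurable]: "lp_norm p \<in> borel_measurable borel"
proof -
  have "(\<lambda>x :: real ^ 'n. x $ i) \<in> borel_measurable borel" for i
    by (intro borel_measurable_continuous_onI continuous_intros)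
  note [measurable] = this
  have [measurable]: "(infnorm :: real ^ 'n \<Rightarrow> real) \<in> borel_measurable borel"
    by (intro borel_measurable_continuous_onI continuous_on_infnorm continuous_on_id)
  show ?thesis
    by (cases "p = \<infinity>") (simp_all add: lp_norm_def[abs_def])
qed

section \<open>Worst-case risk over a Wasserstein ball\<close>

lemma closed_support_set: "closed (support_set B b)"
proof -
  have "support_set B b = (\<Inter>i. {c. (B *v c) $ i \<le> b $ i})"
    by (auto simp: support_set_def less_eq_vec_def)
  also have "closed \<dots>"
    by (intro closed_INT ballI closed_Collect_le continuous_intros)
  finally show ?thesis .
qed

lemma inner_nonneg_vec: "0 \<le> (u :: real ^ 'n) \<Longrightarrow> 0 \<le> v \<Longrightarrow> 0 \<le> u \<bullet> v"
  by (auto simp: inner_vec_def less_eq_vec_def intro!: sum_nonneg)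

lemma inner_mono_vec: "(u :: real ^ 'n) \<le> v \<Longrightarrow> 0 \<le> w \<Longrightarrow> u \<bullet> w \<le> v \<bullet> w"
  using inner_nonneg_vec[of "v - u" w] by (simp add: inner_diff_left)

lemma inner_transpose: "x \<bullet> (transpose A *v u) = (A *v x) \<bullet> u" for A :: "real ^ 'n ^ 'm"
  by (metis dot_lmul_matrix inner_commute transpose_matrix_vector)

text \<open>The matrices of the linear programs below contain Kronecker deltas in the sample index;
  this lemma and the next collapse the resulting sums.\<close>

lemma sum_delta_single:
  fixes g h :: "'a \<Rightarrow> real"
  assumes "j \<in> K" "finite K"
  shows "(\<Sum>i\<in>K. (if i = j then h i else 0) * g i) = h j * g j"
proof -
  have "(\<Sum>i\<in>K. (if i = j then h i else 0) * g i) = (\<Sum>i\<in>K. if i = j then h j * g j else 0)"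
    by (intro sum.cong refl) simp
  with assms show ?thesis by simp
qed

lemma sum_delta_pair:
  fixes g h :: "'a \<times> 'b \<Rightarrow> real"
  assumes "j \<in> K" "finite K"
  shows "(\<Sum>i\<in>K \<times> E. (if fst i = j then h i else 0) * g i) = (\<Sum>e\<in>E. h (j, e) * g (j, e))"
proof -
  have "(\<Sum>i\<in>K \<times> E. (if fst i = j then h i else 0) * g i) =
      (\<Sum>j'\<in>K. if j' = j then (\<Sum>e\<in>E. h (j', e) * g (j', e)) else 0)"
    unfolding sum.cartesian_product' by (intro sum.cong refl) simp
  with assms show ?thesis by simp
qed

text \<open>
  Sample point \<open>j\<close> carries mass \<open>1 / k\<close>, of which \<open>a j\<close> sits on \<open>(j, True)\<close> and is to be moved, and the
  rest on \<open>(j, False)\<close> and stays in place.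
\<close>

definition split_weight :: "nat \<Rightarrow> (nat \<Rightarrow> real) \<Rightarrow> nat \<times> bool \<Rightarrow> real" where
  "split_weight k a = (\<lambda>(j, moved). if moved then a j else 1 / real k - a j)"

text \<open>The mass sits on labels instead of points, so coinciding data points do no harm, and a
  transport plan and both its marginals are push-forwards of this one measure.\<close>

definition split_measure :: "nat \<Rightarrow> (nat \<Rightarrow> real) \<Rightarrow> (nat \<times> bool) measure" where
  "split_measure k a = point_measure ({1..k} \<times> UNIV) (\<lambda>i. ennreal (split_weight k a i))"

lemma space_split_measure [simp]: "space (split_measure k a) = {1..k} \<times> UNIV"
  by (simp add: split_measure_def space_point_measure)

lemma measurable_split_measure [simp]:
  "g \<in> measurable (split_measure k a) M \<longleftrightarrow> g \<in> {1..k} \<times> UNIV \<rightarrow> space M"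
  by (simp add: split_measure_def)

lemma sum_split: "(\<Sum>i\<in>K \<times> UNIV. g i) = (\<Sum>j\<in>K. g (j, True) + g (j, False))"
  for g :: "nat \<times> bool \<Rightarrow> 'a :: comm_monoid_add"
  by (simp add: sum.cartesian_product' UNIV_bool add.commute)

lemma nn_integral_split_measure:
  "(\<integral>\<^sup>+ i. g i \<partial>split_measure k a) =
    (\<Sum>j\<in>{1..k}. ennreal (a j) * g (j, True) + ennreal (1 / real k - a j) * g (j, False))"
  by (simp add: split_measure_def nn_integral_point_measure_finite sum_split split_weight_def)

lemma integral_split_measure:
  assumes "\<And>j. j \<in> {1..k} \<Longrightarrow> 0 \<le> a j \<and> a j \<le> 1 / real k"
  shows "(\<integral> i. g i \<partial>split_measure k a) =
    (\<Sum>j\<in>{1..k}. a j * g (j, True) + (1 / real k - a j) * g (j, False) :: real)"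
proof -
  have "(\<integral> i. g i \<partial>split_measure k a) = (\<Sum>i\<in>{1..k} \<times> UNIV. split_weight k a i *\<^sub>R g i)"
    unfolding split_measure_def
    by (rule lebesgue_integral_point_measure_finite) (use assms in \<open>auto simp: split_weight_def\<close>)
  then show ?thesis by (simp add: sum_split split_weight_def)
qed

text \<open>The two portions of each atom recombine to \<open>1 / k\<close>. The bounds on
  \<open>a\<close> keep both nonnegative, since \<open>ennreal\<close> truncates negative weights to
  0.\<close>

lemma distr_split_measure:
  assumes "\<And>j. j \<in> {1..k} \<Longrightarrow> 0 \<le> a j \<and> a j \<le> 1 / real k"
  shows "distr (split_measure k a) borel (\<lambda>i. c (fst i)) = empirical k c"
proof (rule measure_eqI)
  fix A assume "A \<in> sets (distr (split_measure k a) borel (\<lambda>i. c (fst i)))"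
  then have [measurable]: "A \<in> sets borel" by simp
  have "emeasure (distr (split_measure k a) borel (\<lambda>i. c (fst i))) A =
      (\<integral>\<^sup>+ x. indicator A x \<partial>distr (split_measure k a) borel (\<lambda>i. c (fst i)))"
    by simp
  also have "\<dots> = (\<integral>\<^sup>+ i. indicator A (c (fst i)) \<partial>split_measure k a)"
    by (rule nn_integral_distr) simp_all
  also have "\<dots> = (\<Sum>j\<in>{1..k}. (ennreal (a j) + ennreal (1 / real k - a j)) * indicator A (c j))"
    by (simp add: nn_integral_split_measure distrib_right)
  also have "\<dots> = (\<Sum>j\<in>{1..k}. ennreal (1 / real k) * indicator A (c j))"
    by (intro sum.cong refl) (use assms in \<open>simp flip: ennreal_plus\<close>)
  also have "\<dots> = emeasure (empirical k c) A"
    by (simp add: emeasure_empirical sum_distrib_left)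
  finally show "emeasure (distr (split_measure k a) borel (\<lambda>i. c (fst i))) A =
    emeasure (empirical k c) A" .
qed simp

text \<open>With nothing to move, the empirical measure is a push-forward of a finite point measure,
  where integrals are sums.\<close>

lemma nn_integral_empirical:
  assumes [measurable]: "g \<in> borel_measurable borel"
  shows "(\<integral>\<^sup>+ x. g x \<partial>empirical k c) = (\<Sum>j\<in>{1..k}. ennreal (1 / real k) * g (c j))"
proof -
  have "(\<integral>\<^sup>+ x. g x \<partial>distr (split_measure k (\<lambda>_. 0)) borel (\<lambda>i. c (fst i))) =
      (\<Sum>j\<in>{1..k}. ennreal (1 / real k) * g (c j))"
    by (subst nn_integral_distr) (simp_all add: nn_integral_split_measure)
  then show ?thesis by (subst (asm) distr_split_measure) auto
qed

text \<open>One setting for both players: each instantiates it with its own data, level and radius,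
  and the follower's problem is the leader's at \<open>- y\<close>.\<close>

locale robust_cvar =
  fixes p q :: ennreal
    and B :: "real ^ 'n ^ 'b" and b :: "real ^ 'b"
    and k :: nat and c :: "nat \<Rightarrow> real ^ 'n"
    and \<alpha> \<epsilon> :: real
  assumes conjugate: "conjugate p q"
    and bounded: "bounded (support_set B b)"
    and size: "1 \<le> k"
    and data: "\<And>j. j \<in> {1..k} \<Longrightarrow> c j \<in> support_set B b"
    and level: "0 < \<alpha>" "\<alpha> < 1"
    and radius: "0 \<le> \<epsilon>"
begin

abbreviation "S \<equiv> support_set B b"

abbreviation "\<Q> \<equiv> ambiguity_set p S (empirical k c) \<epsilon>"

definition objective :: "(nat \<Rightarrow> real) \<Rightarrow> real \<Rightarrow> real \<Rightarrow> real" where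
  "objective s lam t = t + 1 / (1 - \<alpha>) * (\<epsilon> * lam + 1 / real k * (\<Sum>j\<in>{1..k}. s j))"

lemma slack_nonneg: "j \<in> {1..k} \<Longrightarrow> 0 \<le> slack B b (c j)"
  using data by (simp add: slack_def support_set_def)

section \<open>Bounds and integrability from the boundedness of the support\<close>

lemma inner_bounded: "\<exists>R\<ge>0. \<forall>x\<in>S. \<bar>x \<bullet> y\<bar> \<le> R"
proof -
  obtain R where R: "0 < R" "\<And>x. x \<in> S \<Longrightarrow> norm x \<le> R"
    using bounded unfolding bounded_pos by blast
  have "\<bar>x \<bullet> y\<bar> \<le> R * norm y" if "x \<in> S" for x
  proof -
    have "\<bar>x \<bullet> y\<bar> \<le> norm x * norm y" by (rule Cauchy_Schwarz_ineq2)
    also have "\<dots> \<le> R * norm y" using R(2)[OF that] by (intro mult_right_mono) auto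
    finally show ?thesis .
  qed
  moreover have "0 \<le> R * norm y" using R(1) by simp
  ultimately show ?thesis by blast
qed

lemma AE_support:
  assumes "Q \<in> distributions_on S"
  shows "AE x in Q. x \<in> S"
proof -
  interpret prob_space Q using assms by (simp add: distributions_on_def)
  have "S \<in> sets Q"
    using assms closed_support_set[of B b] by (auto simp: distributions_on_def)
  moreover have "prob S = 1"
    using assms by (simp add: distributions_on_def measure_def)
  ultimately show ?thesis by (simp add: prob_eq_1)
qed

lemma integrable_excess:
  assumes "Q \<in> distributions_on S"
  shows "integrable Q (\<lambda>x. max (x \<bullet> y - t) 0)"
proof -
  interpret prob_space Q using assms by (simp add: distributions_on_def)
  have [measurable_cong]: "sets Q = sets borel" using assms by (simp add: distributions_on_def)
  obtain R where "0 \<le> R" "\<forall>x\<in>S. \<bar>x \<bullet> y\<bar> \<le> R" using inner_bounded by blast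
  then have "AE x in Q. norm (max (x \<bullet> y - t) 0) \<le> R + \<bar>t\<bar>"
    using AE_support[OF assms] by (auto elim!: eventually_mono)
  then show ?thesis by (rule integrable_const_bound) measurable
qed

text \<open>A real \<open>INF\<close> is informative only if bounded below. If \<open>R\<close>
  bounds the profit on \<open>S\<close>, the expected excess is at least \<open>- R - t\<close>, and
  its factor \<open>1 / (1 - \<alpha>)\<close> is at least 1, so \<open>- R\<close> is a lower
  bound.\<close>

lemma bdd_below_risk:
  assumes "Q \<in> distributions_on S"
  shows "bdd_below (range (\<lambda>t. t + 1 / (1 - \<alpha>) * (\<integral>x. max (x \<bullet> y - t) 0 \<partial>Q)))"
proof -
  interpret prob_space Q using assms by (simp add: distributions_on_def)
  obtain R where R: "\<forall>x\<in>S. \<bar>x \<bullet> y\<bar> \<le> R" using inner_bounded by blast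
  show ?thesis
  proof (rule bdd_belowI2)
    fix t
    let ?I = "\<integral>x. max (x \<bullet> y - t) 0 \<partial>Q"
    have "- R - t \<le> ?I"
    proof (rule integral_ge_const[OF integrable_excess[OF assms]])
      show "AE x in Q. - R - t \<le> max (x \<bullet> y - t) 0"
        using AE_support[OF assms] R by (auto elim!: eventually_mono)
    qed
    moreover have "1 * ?I \<le> 1 / (1 - \<alpha>) * ?I"
      using level by (intro mult_right_mono) auto
    ultimately show "- R \<le> t + 1 / (1 - \<alpha>) * ?I" by linarith
  qed
qed

text \<open>The leader's system does not list this sign; the norm constraint of the first sample
  implies it.\<close>

lemma lam_nonneg:
  assumes "leader_constraints q B b k c y \<nu> s lam t"
  shows "0 \<le> lam"
proof -
  have "1 \<in> {1..k}" using size by simp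
  then have "lp_norm q (transpose B *v \<nu> 1 - y) \<le> lam"
    using assms unfolding leader_constraints_def by blast
  then show ?thesis
    using lp_norm_nonneg[OF conjugate_sym[OF conjugate]] by (rule order_trans[rotated])
qed

text \<open>Split \<open>(x - c j) \<bullet> y\<close> along \<open>transpose B *v \<nu> j\<close>.
  That part is at most the slack term because \<open>x\<close> lies in \<open>S\<close> and
  \<open>\<nu> j\<close> is nonnegative; the remainder is at most \<open>lam\<close> times the
  distance by Hoelder.\<close>

lemma excess_le:
  assumes "leader_constraints q B b k c y \<nu> s lam t" "j \<in> {1..k}" "x \<in> S"
  shows "max (x \<bullet> y - t) 0 \<le> s j + lam * lp_norm p (x - c j)"
proof -
  have cons: "c j \<bullet> y - t + slack B b (c j) \<bullet> \<nu> j \<le> s j"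
    "lp_norm q (transpose B *v \<nu> j - y) \<le> lam" "0 \<le> \<nu> j" "0 \<le> s j"
    using assms by (auto simp: leader_constraints_def)
  have lam: "0 \<le> lam" using assms(1) by (rule lam_nonneg)
  have "(x - c j) \<bullet> (y - transpose B *v \<nu> j) \<le> lp_norm p (x - c j) * lp_norm q (y - transpose B *v \<nu> j)"
    by (rule lp_norm_hoelder[OF conjugate])
  also have "lp_norm q (y - transpose B *v \<nu> j) = lp_norm q (transpose B *v \<nu> j - y)"
    using lp_norm_minus[OF conjugate_sym[OF conjugate], of "transpose B *v \<nu> j - y"] by simp
  also have "lp_norm p (x - c j) * \<dots> \<le> lp_norm p (x - c j) * lam"
    using cons(2) lp_norm_nonneg[OF conjugate] by (rule mult_left_mono)
  finally have 1: "(x - c j) \<bullet> (y - transpose B *v \<nu> j) \<le> lam * lp_norm p (x - c j)"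
    by (simp add: mult.commute)
  have "(x - c j) \<bullet> (transpose B *v \<nu> j) = (B *v x - B *v c j) \<bullet> \<nu> j"
    by (simp add: inner_transpose inner_commute matrix_vector_mult_diff_distrib
        del: transpose_matrix_vector)
  also have "\<dots> \<le> slack B b (c j) \<bullet> \<nu> j"
    unfolding slack_def using assms(3) cons(3)
    by (intro inner_mono_vec) (simp_all add: support_set_def)
  finally have "x \<bullet> y - t \<le> s j + lam * lp_norm p (x - c j)"
    using 1 cons(1) by (simp add: inner_diff_left inner_diff_right)
  moreover have "0 \<le> s j + lam * lp_norm p (x - c j)"
    using cons lam lp_norm_nonneg[OF conjugate, of "x - c j"] by simp
  ultimately show ?thesis by simp
qed

text \<open>Weak duality: the pointwise bound is integrated along a coupling of nearly minimal cost.
  A coupling records locations but not sample indices, so the bound must first be expressed by a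
  function of the location.\<close>

lemma expected_excess_le:
  assumes Q: "Q \<in> \<Q>" and cons: "leader_constraints q B b k c y \<nu> s lam t"
  shows "(\<integral>x. max (x \<bullet> y - t) 0 \<partial>Q) \<le> \<epsilon> * lam + 1 / real k * (\<Sum>j\<in>{1..k}. s j)" (is "?I \<le> _")
proof -
  define N :: "real ^ 'n \<Rightarrow> real" where "N = lp_norm p"
  have N: "0 \<le> N v" "N (u + v) \<le> N u + N v" "N (- v) = N v" "N 0 = 0" for u v
    using conjugate by (simp_all add: N_def lp_norm_nonneg lp_norm_triangle lp_norm_minus lp_norm_zero)
  have [measurable]: "N \<in> borel_measurable borel" by (simp add: N_def)
  have distQ: "Q \<in> distributions_on S" and W: "wasserstein p (empirical k c) Q \<le> ennreal \<epsilon>"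
    using Q by (auto simp: ambiguity_set_def)
  have [measurable_cong]: "sets Q = sets borel" using distQ by (simp add: distributions_on_def)
  have lam: "0 \<le> lam" using cons by (rule lam_nonneg)
  have s: "0 \<le> s j" if "j \<in> {1..k}" for j
    using cons that by (auto simp: leader_constraints_def)
  \<comment> \<open>the largest \<open>lam\<close>-Lipschitz function below \<open>s j\<close> at \<open>c j\<close>; unlike \<open>s\<close> it depends only on
    the location of a data point, also when data points coincide\<close>
  define g where "g x = Min ((\<lambda>j. s j + lam * N (x - c j)) ` {1..k})" for x
  have fin: "finite ((\<lambda>j. s j + lam * N (x - c j)) ` {1..k})"
    "(\<lambda>j. s j + lam * N (x - c j)) ` {1..k} \<noteq> {}" for x
    using size by auto
  have [measurable]: "g \<in> borel_measurable borel"
    unfolding g_def[abs_def] by (rule borel_measurable_Min) auto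
  have g_nonneg: "0 \<le> g x" for x
    unfolding g_def using fin[of x] s lam N(1) by (simp add: Min_ge_iff)
  have g_data: "g (c j) \<le> s j" if "j \<in> {1..k}" for j
    unfolding g_def using that by (intro order_trans[OF Min_le[OF fin(1)]]) (auto simp: N)
  \<comment> \<open>By the triangle inequality the bound from each data point extends to an
    arbitrary starting location \<open>x'\<close>.\<close>
  have le: "max (x \<bullet> y - t) 0 \<le> g x' + lam * N (x' - x)" if "x \<in> S" for x x'
  proof -
    have "max (x \<bullet> y - t) 0 - lam * N (x' - x) \<le> s j + lam * N (x' - c j)" if "j \<in> {1..k}" for j
    proof -
      have "N (x - c j) \<le> N (x - x') + N (x' - c j)" using N(2)[of "x - x'" "x' - c j"] by simp
      also have "N (x - x') = N (x' - x)" using N(3)[of "x' - x"] by simp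
      finally have "lam * N (x - c j) \<le> lam * N (x' - x) + lam * N (x' - c j)"
        using lam by (metis distrib_left mult_left_mono)
      with excess_le[OF cons that \<open>x \<in> S\<close>] show ?thesis unfolding N_def by linarith
    qed
    then have "max (x \<bullet> y - t) 0 - lam * N (x' - x) \<le> g x'"
      unfolding g_def using fin[of x'] by (simp add: Min_ge_iff)
    then show ?thesis by linarith
  qed
  have "(\<integral>\<^sup>+ x. ennreal (g x) \<partial>empirical k c) = (\<Sum>j\<in>{1..k}. ennreal (1 / real k * g (c j)))"
    by (subst nn_integral_empirical) (use g_nonneg in \<open>auto simp flip: ennreal_mult\<close>)
  also have "\<dots> \<le> ennreal (1 / real k * (\<Sum>j\<in>{1..k}. s j))"
    using g_nonneg g_data
    by (subst sum_ennreal) (auto simp: sum_distrib_left divide_right_mono intro!: ennreal_leI sum_mono)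
  finally have intg: "(\<integral>\<^sup>+ x. ennreal (g x) \<partial>empirical k c) \<le> ennreal (1 / real k * (\<Sum>j\<in>{1..k}. s j))" .
  have sum_nn: "0 \<le> 1 / real k * (\<Sum>j\<in>{1..k}. s j)"
    by (intro mult_nonneg_nonneg sum_nonneg s) auto
  have I: "ennreal ?I = (\<integral>\<^sup>+ x. ennreal (max (x \<bullet> y - t) 0) \<partial>Q)"
    by (rule nn_integral_eq_integral[OF integrable_excess[OF distQ], symmetric]) simp
  \<comment> \<open>The slack \<open>\<delta>\<close> is there because the infimum over couplings is
    not known to be attained.\<close>
  have bound: "?I \<le> 1 / real k * (\<Sum>j\<in>{1..k}. s j) + lam * (\<epsilon> + \<delta>)" if "0 < \<delta>" for \<delta>
  proof -
    have "wasserstein p (empirical k c) Q < ennreal (\<epsilon> + \<delta>)"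
      using W that radius by (meson ennreal_lessI less_add_same_cancel1 add_nonneg_pos order_le_less_trans)
    then obtain \<pi> where \<pi>: "\<pi> \<in> couplings (empirical k c) Q"
      and cost: "(\<integral>\<^sup>+ z. ennreal (N (fst z - snd z)) \<partial>\<pi>) < ennreal (\<epsilon> + \<delta>)"
      unfolding wasserstein_def INF_less_iff N_def by blast
    have [measurable_cong]: "sets \<pi> = sets (borel \<Otimes>\<^sub>M borel)"
      and P_eq: "distr \<pi> borel fst = empirical k c" and Q_eq: "distr \<pi> borel snd = Q"
      using \<pi> by (auto simp: couplings_def)
    have "AE z in \<pi>. snd z \<in> S"
      using AE_support[OF distQ] unfolding Q_eq[symmetric] by (rule AE_distrD[rotated]) measurable
    then have AE: "AE z in \<pi>. ennreal (max (snd z \<bullet> y - t) 0) \<le>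
        ennreal (g (fst z)) + ennreal lam * ennreal (N (fst z - snd z))"
    proof (rule eventually_mono)
      fix z :: "(real ^ 'n) \<times> (real ^ 'n)" assume "snd z \<in> S"
      from ennreal_leI[OF le[OF this, of "fst z"]]
      show "ennreal (max (snd z \<bullet> y - t) 0) \<le>
        ennreal (g (fst z)) + ennreal lam * ennreal (N (fst z - snd z))"
        using lam g_nonneg N(1) by (simp add: ennreal_plus ennreal_mult)
    qed
    have "ennreal ?I = (\<integral>\<^sup>+ x. ennreal (max (x \<bullet> y - t) 0) \<partial>distr \<pi> borel snd)"
      unfolding I Q_eq ..
    also have "\<dots> = (\<integral>\<^sup>+ z. ennreal (max (snd z \<bullet> y - t) 0) \<partial>\<pi>)"
      by (rule nn_integral_distr) measurable
    also have "\<dots> \<le> (\<integral>\<^sup>+ z. ennreal (g (fst z)) + ennreal lam * ennreal (N (fst z - snd z)) \<partial>\<pi>)"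
      by (rule nn_integral_mono_AE[OF AE])
    also have "\<dots> = (\<integral>\<^sup>+ z. ennreal (g (fst z)) \<partial>\<pi>) +
        ennreal lam * (\<integral>\<^sup>+ z. ennreal (N (fst z - snd z)) \<partial>\<pi>)"
      by (subst nn_integral_add) (measurable, simp add: nn_integral_cmult)
    also have "(\<integral>\<^sup>+ z. ennreal (g (fst z)) \<partial>\<pi>) = (\<integral>\<^sup>+ x. ennreal (g x) \<partial>distr \<pi> borel fst)"
      by (rule nn_integral_distr[symmetric]) measurable
    also have "\<dots> + ennreal lam * (\<integral>\<^sup>+ z. ennreal (N (fst z - snd z)) \<partial>\<pi>) \<le>
        ennreal (1 / real k * (\<Sum>j\<in>{1..k}. s j)) + ennreal lam * ennreal (\<epsilon> + \<delta>)"
      unfolding P_eq by (intro add_mono mult_left_mono intg less_imp_le[OF cost]) simp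
    also have "\<dots> = ennreal (1 / real k * (\<Sum>j\<in>{1..k}. s j) + lam * (\<epsilon> + \<delta>))"
      using sum_nn lam radius that by (simp add: ennreal_plus ennreal_mult)
    finally show ?thesis
      using sum_nn lam radius that by (subst (asm) ennreal_le_iff) auto
  qed
  show ?thesis
  proof (rule field_le_epsilon)
    fix e :: real assume "0 < e"
    \<comment> \<open>Dividing by \<open>lam + 1\<close> also covers \<open>lam = 0\<close>.\<close>
    then have "0 < e / (lam + 1)" "lam * (e / (lam + 1)) \<le> e"
      using lam by (auto simp: field_simps)
    with bound[of "e / (lam + 1)"]
    show "?I \<le> \<epsilon> * lam + 1 / real k * (\<Sum>j\<in>{1..k}. s j) + e"
      by (simp add: algebra_simps)
  qed
qed

lemma risk_le_objective:
  assumes "Q \<in> \<Q>" and "leader_constraints q B b k c y \<nu> s lam t"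
  shows "risk_leader \<alpha> y Q \<le> objective s lam t"
proof -
  have "Q \<in> distributions_on S" using assms(1) by (auto simp: ambiguity_set_def)
  then have "risk_leader \<alpha> y Q \<le> t + 1 / (1 - \<alpha>) * (\<integral>x. max (x \<bullet> y - t) 0 \<partial>Q)"
    unfolding risk_leader_def by (intro cINF_lower bdd_below_risk) auto
  also have "\<dots> \<le> objective s lam t"
    unfolding objective_def
    by (intro add_left_mono mult_left_mono expected_excess_le[OF assms]) (use level in auto)
  finally show ?thesis .
qed

text \<open>A nonzero recession direction would give a ray inside the bounded set \<open>S\<close>,
  starting at the data point \<open>c 1\<close>.\<close>

lemma recession_cone:
  assumes "B *v w \<le> 0"
  shows "w = 0"
proof (rule ccontr)
  assume "w \<noteq> 0"
  obtain R where R: "0 < R" "\<And>x. x \<in> S \<Longrightarrow> norm x \<le> R"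
    using bounded unfolding bounded_pos by blast
  have S: "c 1 \<in> S" using data size by simp
  \<comment> \<open>Chosen so that \<open>r *\<^sub>R w\<close> is longer than a difference of a
    point of \<open>S\<close> and \<open>c 1\<close> can be.\<close>
  define r where "r = (R + norm (c 1) + 1) / norm w"
  have "0 \<le> r" using R(1) by (simp add: r_def)
  have "r *\<^sub>R (B *v w) \<le> 0"
    using assms \<open>0 \<le> r\<close> by (auto simp: less_eq_vec_def mult_nonneg_nonpos)
  then have "B *v (c 1 + r *\<^sub>R w) \<le> b + 0"
    using S by (simp only: matrix_vector_right_distrib matrix_vector_mult_scaleR)
      (intro add_mono, auto simp: support_set_def)
  then have "norm (c 1 + r *\<^sub>R w) \<le> R" by (intro R) (simp add: support_set_def)
  moreover have "norm (r *\<^sub>R w) = R + norm (c 1) + 1"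
    using \<open>w \<noteq> 0\<close> R(1) by (simp add: r_def add_nonneg_nonneg)
  moreover have "norm (r *\<^sub>R w) \<le> norm (c 1 + r *\<^sub>R w) + norm (c 1)"
    using norm_triangle_ineq4[of "c 1 + r *\<^sub>R w" "c 1"] by simp
  ultimately show False by simp
qed

text \<open>
  From a dual solution, mass \<open>(1 - \<alpha>) \<gamma>\<^sub>j\<close> of the \<open>j\<close>-th data point is transported
  to \<open>c\<^sub>j + w\<^sub>j / \<gamma>\<^sub>j\<close>; when \<open>\<gamma>\<^sub>j = 0\<close> the vector \<open>w\<^sub>j\<close> vanishes because \<open>S\<close> is bounded.
\<close>

lemma worst_case_distribution:
  assumes \<gamma>: "\<And>j. j \<in> {1..k} \<Longrightarrow> 0 \<le> \<gamma> j \<and> \<gamma> j \<le> 1 / ((1 - \<alpha>) * real k)"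
    and total: "(\<Sum>j\<in>{1..k}. \<gamma> j) = 1"
    and w: "\<And>j. j \<in> {1..k} \<Longrightarrow> B *v w j \<le> \<gamma> j *\<^sub>R slack B b (c j)"
    and budget: "(\<Sum>j\<in>{1..k}. lp_norm p (w j)) \<le> 1 / (1 - \<alpha>) * \<epsilon>"
  shows "\<exists>Q\<in>\<Q>. \<forall>y t. (\<Sum>j\<in>{1..k}. \<gamma> j * (c j \<bullet> y) + w j \<bullet> y) \<le>
    t + 1 / (1 - \<alpha>) * (\<integral>x. max (x \<bullet> y - t) 0 \<partial>Q)"
proof -
  define a where "a j = (1 - \<alpha>) * \<gamma> j" for j
  \<comment> \<open>For \<open>\<gamma> j = 0\<close> division by zero yields 0, so
    \<open>d j = c j\<close> remains in \<open>S\<close>.\<close>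
  define d where "d j = c j + (1 / \<gamma> j) *\<^sub>R w j" for j
  define g where "g = (\<lambda>(j, moved). if moved then d j else c j)"
  define Q where "Q = distr (split_measure k a) borel g"
  define \<pi> where "\<pi> = distr (split_measure k a) (borel \<Otimes>\<^sub>M borel) (\<lambda>i. (c (fst i), g i))"
  \<comment> \<open>The cap on \<open>\<gamma> j\<close> says exactly that no more than the
    available mass \<open>1 / k\<close> is moved.\<close>
  have a: "0 \<le> a j \<and> a j \<le> 1 / real k" if "j \<in> {1..k}" for j
  proof -
    have "a j \<le> (1 - \<alpha>) * (1 / ((1 - \<alpha>) * real k))"
      unfolding a_def using \<gamma>[OF that] level by (intro mult_left_mono) auto
    then show ?thesis using \<gamma>[OF that] level by (simp add: a_def)
  qed
  have w0: "w j = 0" if "j \<in> {1..k}" "\<gamma> j = 0" for j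
    using w[OF that(1)] that(2) by (intro recession_cone) simp
  have d: "d j \<in> S" if j: "j \<in> {1..k}" for j
  proof (cases "\<gamma> j = 0")
    case True
    then show ?thesis using data[OF j] by (simp add: d_def)
  next
    case False
    then have "0 < \<gamma> j" using \<gamma>[OF j] by simp
    then have "(1 / \<gamma> j) *\<^sub>R (B *v w j) \<le> slack B b (c j)"
      using w[OF j] by (auto simp: less_eq_vec_def field_simps)
    then show ?thesis
      by (simp add: support_set_def d_def slack_def matrix_vector_right_distrib
          matrix_vector_mult_scaleR le_diff_eq add.commute)
  qed
  have g: "g i \<in> S" if "i \<in> {1..k} \<times> UNIV" for i
    using that d data by (auto simp: g_def split: prod.splits)
  have M0: "prob_space (split_measure k a)"
  proof
    have "emeasure (split_measure k a) (space (split_measure k a)) = (\<integral>\<^sup>+ i. 1 \<partial>split_measure k a)"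
      by simp
    also have "\<dots> = (\<Sum>j\<in>{1..k}. ennreal (1 / real k))"
      unfolding nn_integral_split_measure
      by (intro sum.cong refl) (use a in \<open>simp flip: ennreal_plus\<close>)
    also have "\<dots> = 1"
      using size by (subst sum_ennreal) auto
    finally show "emeasure (split_measure k a) (space (split_measure k a)) = 1" .
  qed
  have probQ: "prob_space Q"
    unfolding Q_def by (rule prob_space.prob_space_distr[OF M0]) simp
  have prob\<pi>: "prob_space \<pi>"
    unfolding \<pi>_def by (rule prob_space.prob_space_distr[OF M0]) (simp add: space_pair_measure)
  have S: "S \<in> sets borel" using closed_support_set[of B b] by simp
  have "emeasure Q S = emeasure (split_measure k a) (g -` S \<inter> space (split_measure k a))"
    unfolding Q_def by (rule emeasure_distr) (use S in simp_all)
  also have "g -` S \<inter> space (split_measure k a) = space (split_measure k a)"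
    using g by auto
  finally have "emeasure Q S = 1"
    using prob_space.emeasure_space_1[OF M0] by simp
  then have distQ: "Q \<in> distributions_on S"
    using probQ by (simp add: distributions_on_def Q_def)
  have "distr \<pi> borel fst = distr (split_measure k a) borel (\<lambda>i. c (fst i))"
    unfolding \<pi>_def by (subst distr_distr) (auto simp: space_pair_measure comp_def)
  moreover have "distr \<pi> borel snd = Q"
    unfolding \<pi>_def Q_def by (subst distr_distr) (auto simp: space_pair_measure comp_def)
  ultimately have \<pi>: "\<pi> \<in> couplings (empirical k c) Q"
    using prob\<pi> distr_split_measure[OF a] by (simp add: couplings_def \<pi>_def)
  have "(\<integral>\<^sup>+ z. ennreal (lp_norm p (fst z - snd z)) \<partial>\<pi>) =
      (\<integral>\<^sup>+ i. ennreal (lp_norm p (c (fst i) - g i)) \<partial>split_measure k a)"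
    unfolding \<pi>_def by (subst nn_integral_distr) (simp_all add: space_pair_measure)
  also have "\<dots> = (\<Sum>j\<in>{1..k}. ennreal (a j) * ennreal (lp_norm p (c j - d j)))"
    unfolding nn_integral_split_measure by (simp add: g_def lp_norm_zero[OF conjugate])
  \<comment> \<open>The moved mass \<open>(1 - \<alpha>) * \<gamma> j\<close> cancels the factor
    \<open>1 / \<gamma> j\<close> in the displacement, so the cost is linear in the norms of
    \<open>w j\<close>.\<close>
  also have "\<dots> = (\<Sum>j\<in>{1..k}. ennreal ((1 - \<alpha>) * lp_norm p (w j)))"
  proof (intro sum.cong refl)
    fix j assume j: "j \<in> {1..k}"
    have "a j * lp_norm p (c j - d j) = (1 - \<alpha>) * lp_norm p (w j)"
    proof (cases "\<gamma> j = 0")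
      case True
      then show ?thesis by (simp add: a_def w0[OF j] lp_norm_zero[OF conjugate])
    next
      case False
      have "c j - d j = - ((1 / \<gamma> j) *\<^sub>R w j)" by (simp add: d_def)
      with False show ?thesis
        using \<gamma>[OF j] by (simp only: lp_norm_minus[OF conjugate] lp_norm_scaleR[OF conjugate]) (simp add: a_def)
    qed
    then show "ennreal (a j) * ennreal (lp_norm p (c j - d j)) = ennreal ((1 - \<alpha>) * lp_norm p (w j))"
      using a[OF j] lp_norm_nonneg[OF conjugate, of "c j - d j"] by (simp flip: ennreal_mult)
  qed
  also have "\<dots> = ennreal ((1 - \<alpha>) * (\<Sum>j\<in>{1..k}. lp_norm p (w j)))"
    using level lp_norm_nonneg[OF conjugate, where 'a = 'n]
    by (subst sum_ennreal) (auto simp: sum_distrib_left)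
  also have "\<dots> \<le> ennreal \<epsilon>"
    using budget level by (intro ennreal_leI) (simp add: field_simps)
  finally have "wasserstein p (empirical k c) Q \<le> ennreal \<epsilon>"
    unfolding wasserstein_def by (intro INF_lower2[OF \<pi>])
  with distQ have "Q \<in> \<Q>" by (simp add: ambiguity_set_def)
  \<comment> \<open>The same \<open>Q\<close> serves all \<open>t\<close>, so the bound survives the
    infimum that defines the risk.\<close>
  moreover have "(\<Sum>j\<in>{1..k}. \<gamma> j * (c j \<bullet> y) + w j \<bullet> y) \<le>
    t + 1 / (1 - \<alpha>) * (\<integral>x. max (x \<bullet> y - t) 0 \<partial>Q)" for y t
  proof -
    have "(1 - \<alpha>) * ((\<Sum>j\<in>{1..k}. \<gamma> j * (c j \<bullet> y) + w j \<bullet> y) - t * (\<Sum>j\<in>{1..k}. \<gamma> j)) =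
        (\<Sum>j\<in>{1..k}. a j * (d j \<bullet> y - t))"
      unfolding sum_distrib_left sum_subtractf[symmetric]
    proof (intro sum.cong refl)
      fix j assume j: "j \<in> {1..k}"
      show "(1 - \<alpha>) * (\<gamma> j * (c j \<bullet> y) + w j \<bullet> y - t * \<gamma> j) = a j * (d j \<bullet> y - t)"
        using w0[OF j] by (cases "\<gamma> j = 0") (auto simp: a_def d_def inner_add_left field_simps)
    qed
    \<comment> \<open>Moved mass has at least its signed excess, and mass left in place contributes
      something nonnegative.\<close>
    also have "\<dots> \<le> (\<Sum>j\<in>{1..k}. a j * max (d j \<bullet> y - t) 0 + (1 / real k - a j) * max (c j \<bullet> y - t) 0)"
    proof (intro sum_mono)
      fix j assume j: "j \<in> {1..k}"
      have "a j * (d j \<bullet> y - t) \<le> a j * max (d j \<bullet> y - t) 0"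
        using a[OF j] by (intro mult_left_mono) auto
      moreover have "0 \<le> (1 / real k - a j) * max (c j \<bullet> y - t) 0"
        using a[OF j] by (intro mult_nonneg_nonneg) auto
      ultimately show "a j * (d j \<bullet> y - t) \<le>
        a j * max (d j \<bullet> y - t) 0 + (1 / real k - a j) * max (c j \<bullet> y - t) 0" by linarith
    qed
    also have "\<dots> = (\<integral>i. max (g i \<bullet> y - t) 0 \<partial>split_measure k a)"
      by (subst integral_split_measure) (use a in \<open>auto simp: g_def\<close>)
    also have "\<dots> = (\<integral>x. max (x \<bullet> y - t) 0 \<partial>Q)"
      unfolding Q_def by (rule integral_distr[symmetric]) simp_all
    finally show ?thesis
      using total level by (simp add: field_simps)
  qed
  ultimately show ?thesis by blast
qed

section \<open>Strong duality for the worst-case risk at fixed \<open>y\<close>\<close>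

lemma leader_feasible: "\<exists>\<nu> s lam t. leader_constraints q B b k c y \<nu> s lam t"
proof -
  have "leader_constraints q B b k c y (\<lambda>_. 0) (\<lambda>j. max (c j \<bullet> y) 0) (lp_norm q y) 0"
    using lp_norm_minus[OF conjugate_sym[OF conjugate], of y] by (auto simp: leader_constraints_def)
  then show ?thesis by blast
qed

lemma bdd_above_risk: "bdd_above (risk_leader \<alpha> y ` \<Q>)"
proof -
  obtain \<nu> s lam t where "leader_constraints q B b k c y \<nu> s lam t"
    using leader_feasible by blast
  then have "risk_leader \<alpha> y Q \<le> objective s lam t" if "Q \<in> \<Q>" for Q
    using risk_le_objective that by blast
  then show ?thesis by (rule bdd_aboveI2)
qed

text \<open>Uniform weights and zero displacement are admissible in
  \<open>worst_case_distribution\<close>; of its conclusion only membership is kept.\<close>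

lemma ambiguity_nonempty: "\<Q> \<noteq> {}"
proof -
  have "\<exists>Q\<in>\<Q>. \<forall>y t. (\<Sum>j\<in>{1..k}. 1 / real k * (c j \<bullet> y) + 0 \<bullet> y) \<le>
    t + 1 / (1 - \<alpha>) * (\<integral>x. max (x \<bullet> y - t) 0 \<partial>Q)"
  proof (rule worst_case_distribution)
    fix j assume j: "j \<in> {1..k}"
    show "0 \<le> 1 / real k \<and> 1 / real k \<le> 1 / ((1 - \<alpha>) * real k)"
      using level size by (auto simp: field_simps)
    show "B *v 0 \<le> (1 / real k) *\<^sub>R slack B b (c j)"
      using slack_nonneg[OF j] by (simp add: less_eq_vec_def)
  qed (use size level radius in \<open>simp_all add: lp_norm_zero[OF conjugate]\<close>)
  then show ?thesis by blast
qed

lemma worst_leader_le_objective: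
  assumes "leader_constraints q B b k c y \<nu> s lam t"
  shows "worst_leader \<alpha> \<Q> y \<le> objective s lam t"
  unfolding worst_leader_def
  using ambiguity_nonempty by (intro cSUP_least risk_le_objective[OF _ assms])

lemma le_worst_leader:
  assumes "Q \<in> \<Q>" "\<And>t. v \<le> t + 1 / (1 - \<alpha>) * (\<integral>x. max (x \<bullet> y - t) 0 \<partial>Q)"
  shows "v \<le> worst_leader \<alpha> \<Q> y"
proof -
  have "v \<le> risk_leader \<alpha> y Q"
    unfolding risk_leader_def using assms(2) by (intro cINF_greatest) auto
  also have "\<dots> \<le> worst_leader \<alpha> \<Q> y"
    unfolding worst_leader_def by (intro cSUP_upper bdd_above_risk assms(1))
  finally show ?thesis .
qed

text \<open>\<open>lp_duality\<close> is applied to the program in \<open>\<gamma>\<close> and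
  \<open>\<eta>\<close>, whose values are bounded by risks of actual distributions. The multipliers
  form a feasible point of value at most the worst case, and weak duality forces equality.\<close>

lemma leader_attained:
  "\<exists>\<nu> s lam t. leader_constraints q B b k c y \<nu> s lam t \<and> objective s lam t = worst_leader \<alpha> \<Q> y"
proof -
  \<comment> \<open>dual problem: variables \<open>\<gamma> j\<close> and \<open>\<eta> (j, e)\<close> with \<open>w j = (\<Sum>e. \<eta> (j, e) *\<^sub>R e)\<close>; the multipliers of
    its rows are \<open>s j\<close>, \<open>\<nu> j $ i\<close>, \<open>lam\<close> and the positive and negative parts of \<open>t\<close>\<close>
  define E :: "(real ^ 'n) set" where "E = ball_vertices p"
  have finE: "finite E" by (simp add: E_def finite_ball_vertices)
  define vars :: "(nat + nat \<times> (real ^ 'n)) set" where "vars = {1..k} <+> {1..k} \<times> E"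
  define rows :: "((nat + nat \<times> 'b) + bool option) set" where
    "rows = ({1..k} <+> {1..k} \<times> UNIV) <+> UNIV"
  \<comment> \<open>Rows in order: the cap on \<open>\<gamma> j\<close>, the support constraint on
    \<open>w j\<close>, the transport budget, and the equation for the total of
    \<open>\<gamma>\<close> as two inequalities.\<close>
  define A :: "(nat + nat \<times> 'b) + bool option \<Rightarrow> nat + nat \<times> (real ^ 'n) \<Rightarrow> real" where
    "A r v = (case r of
        Inl (Inl j) \<Rightarrow> (case v of Inl j' \<Rightarrow> if j' = j then 1 else 0 | Inr _ \<Rightarrow> 0)
      | Inl (Inr ji) \<Rightarrow> (case v of
            Inl j' \<Rightarrow> if j' = fst ji then - slack B b (c j') $ snd ji else 0
          | Inr je \<Rightarrow> if fst je = fst ji then (B *v snd je) $ snd ji else 0)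
      | Inr None \<Rightarrow> (case v of Inl _ \<Rightarrow> 0 | Inr _ \<Rightarrow> 1)
      | Inr (Some pos) \<Rightarrow> (case v of Inl _ \<Rightarrow> if pos then 1 else -1 | Inr _ \<Rightarrow> 0))" for r v
  define rhs :: "(nat + nat \<times> 'b) + bool option \<Rightarrow> real" where
    "rhs r = (case r of
        Inl (Inl j) \<Rightarrow> 1 / ((1 - \<alpha>) * real k)
      | Inl (Inr ji) \<Rightarrow> 0
      | Inr None \<Rightarrow> 1 / (1 - \<alpha>) * \<epsilon>
      | Inr (Some pos) \<Rightarrow> if pos then 1 else -1)" for r
  define cost :: "nat + nat \<times> (real ^ 'n) \<Rightarrow> real" where
    "cost v = (case v of Inl j \<Rightarrow> c j \<bullet> y | Inr je \<Rightarrow> snd je \<bullet> y)" for v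
  have fin: "finite rows" "finite vars" using finE by (simp_all add: rows_def vars_def)
  have in_vars: "Inl j \<in> vars \<longleftrightarrow> j \<in> {1..k}" "Inr je \<in> vars \<longleftrightarrow> je \<in> {1..k} \<times> E" for j je
    by (auto simp: vars_def)
  have in_rows: "Inl (Inl j) \<in> rows \<longleftrightarrow> j \<in> {1..k}"
    "Inl (Inr ji) \<in> rows \<longleftrightarrow> ji \<in> {1..k} \<times> UNIV" "Inr o' \<in> rows" for j ji o'
    by (auto simp: rows_def)
  have sum_vars: "(\<Sum>v\<in>vars. F v) = (\<Sum>j\<in>{1..k}. F (Inl j)) + (\<Sum>i\<in>{1..k} \<times> E. F (Inr i))"
    for F :: "_ \<Rightarrow> real"
    unfolding vars_def using finE by (simp add: sum.Plus)
  have sum_rows: "(\<Sum>r\<in>rows. F r) = (\<Sum>j\<in>{1..k}. F (Inl (Inl j))) +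
      (\<Sum>i\<in>{1..k} \<times> UNIV. F (Inl (Inr i))) + (F (Inr None) + F (Inr (Some True)) + F (Inr (Some False)))"
    for F :: "_ \<Rightarrow> real"
    unfolding rows_def by (simp add: sum.Plus UNIV_option_conv UNIV_bool)
  have row_cap: "(\<Sum>v\<in>vars. A (Inl (Inl j)) v * x v) = x (Inl j)" if "j \<in> {1..k}" for j x
    using sum_delta_single[OF that finite_atLeastAtMost, of "\<lambda>_. 1"] by (simp add: sum_vars A_def)
  have row_support: "(\<Sum>v\<in>vars. A (Inl (Inr (j, i))) v * x v) =
      (B *v (\<Sum>e\<in>E. x (Inr (j, e)) *\<^sub>R e)) $ i - x (Inl j) * slack B b (c j) $ i"
    if "j \<in> {1..k}" for j i x
    using sum_delta_single[OF that finite_atLeastAtMost, of "\<lambda>j'. - slack B b (c j') $ i" "\<lambda>j'. x (Inl j')"]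
      sum_delta_pair[OF that finite_atLeastAtMost,
        where E = E and h = "\<lambda>je. (B *v snd je) $ i" and g = "\<lambda>je. x (Inr je)"]
    by (simp cong: if_cong add: sum_vars A_def mult.commute
        linear_sum[OF matrix_vector_mul_linear] matrix_vector_mult_scaleR)
  have row_budget: "(\<Sum>v\<in>vars. A (Inr None) v * x v) = (\<Sum>j\<in>{1..k}. \<Sum>e\<in>E. x (Inr (j, e)))" for x
    by (simp add: sum_vars A_def sum.cartesian_product')
  have row_total: "(\<Sum>v\<in>vars. A (Inr (Some pos)) v * x v) =
      (if pos then 1 else -1) * (\<Sum>j\<in>{1..k}. x (Inl j))" for x pos
    by (simp add: sum_vars A_def sum_negf)
  have val: "(\<Sum>v\<in>vars. cost v * x v) =
      (\<Sum>j\<in>{1..k}. x (Inl j) * (c j \<bullet> y) + (\<Sum>e\<in>E. x (Inr (j, e)) *\<^sub>R e) \<bullet> y)" for x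
    by (simp add: sum_vars cost_def sum.cartesian_product' sum.distrib inner_sum_left mult.commute)
  have "\<exists>u. (\<forall>r\<in>rows. 0 \<le> u r) \<and> (\<forall>v\<in>vars. cost v \<le> (\<Sum>r\<in>rows. u r * A r v)) \<and>
    (\<Sum>r\<in>rows. u r * rhs r) \<le> worst_leader \<alpha> \<Q> y"
  proof (rule lp_duality[OF fin])
    \<comment> \<open>Uniform weights without displacement show feasibility.\<close>
    let ?x0 = "\<lambda>v :: nat + nat \<times> (real ^ 'n). case v of Inl j \<Rightarrow> 1 / real k | Inr _ \<Rightarrow> 0"
    show "0 \<le> ?x0 v" for v by (simp split: sum.split)
    show "(\<Sum>v\<in>vars. A r v * ?x0 v) \<le> rhs r" if r: "r \<in> rows" for r
    proof -
      consider j where "r = Inl (Inl j)" "j \<in> {1..k}" | j i where "r = Inl (Inr (j, i))" "j \<in> {1..k}"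
        | "r = Inr None" | pos where "r = Inr (Some pos)"
        using r unfolding rows_def by (auto elim!: PlusE) (metis option.exhaust)
      then show ?thesis
      proof cases
        case (1 j)
        then show ?thesis using level size by (simp only: row_cap) (auto simp: rhs_def field_simps)
      next
        case (2 j i)
        then show ?thesis
          using slack_nonneg[of j] by (simp only: row_support) (auto simp: rhs_def less_eq_vec_def)
      next
        case 3
        then show ?thesis using level radius by (simp only: row_budget) (simp add: rhs_def)
      next
        case (4 pos)
        then show ?thesis using size by (simp only: row_total) (simp add: rhs_def)
      qed
    qed
  next
    fix x assume nn: "\<And>v. v \<in> vars \<Longrightarrow> 0 \<le> x v"
      and rows: "\<And>r. r \<in> rows \<Longrightarrow> (\<Sum>v\<in>vars. A r v * x v) \<le> rhs r"
    define w where "w j = (\<Sum>e\<in>E. x (Inr (j, e)) *\<^sub>R e)" for j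
    have nn_e: "0 \<le> x (Inr (j, e))" if "j \<in> {1..k}" "e \<in> E" for j e
      using nn[of "Inr (j, e)"] that by (auto simp: in_vars)
    have "\<exists>Q\<in>\<Q>. \<forall>y t. (\<Sum>j\<in>{1..k}. x (Inl j) * (c j \<bullet> y) + w j \<bullet> y) \<le>
      t + 1 / (1 - \<alpha>) * (\<integral>x. max (x \<bullet> y - t) 0 \<partial>Q)"
    proof (rule worst_case_distribution)
      fix j assume j: "j \<in> {1..k}"
      show "0 \<le> x (Inl j) \<and> x (Inl j) \<le> 1 / ((1 - \<alpha>) * real k)"
        using rows[of "Inl (Inl j)"] nn[of "Inl j"] j by (simp add: row_cap) (auto simp: in_rows in_vars rhs_def)
      have "(B *v w j) $ i \<le> x (Inl j) * slack B b (c j) $ i" for i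
        using rows[of "Inl (Inr (j, i))"] j unfolding w_def
        by (simp only: row_support) (auto simp: in_rows rhs_def)
      then show "B *v w j \<le> x (Inl j) *\<^sub>R slack B b (c j)" by (simp add: less_eq_vec_def)
    next
      have "(\<Sum>j\<in>{1..k}. x (Inl j)) \<le> 1" "- (\<Sum>j\<in>{1..k}. x (Inl j)) \<le> - 1"
        using rows[of "Inr (Some True)"] rows[of "Inr (Some False)"]
        by (simp_all only: row_total) (auto simp: in_rows rhs_def)
      then show "(\<Sum>j\<in>{1..k}. x (Inl j)) = 1" by linarith
    next
      \<comment> \<open>Vertices have norm at most 1, so the budget on their weights controls the
        norm of \<open>w j\<close>.\<close>
      have "lp_norm p (w j) \<le> (\<Sum>e\<in>E. x (Inr (j, e)))" if "j \<in> {1..k}" for j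
      proof -
        have "lp_norm p (w j) \<le> (\<Sum>e\<in>E. x (Inr (j, e)) * lp_norm p e)"
          unfolding w_def using nn_e[OF that]
          by (intro order_trans[OF lp_norm_sum[OF conjugate]] sum_mono)
            (simp add: lp_norm_scaleR[OF conjugate])
        also have "\<dots> \<le> (\<Sum>e\<in>E. x (Inr (j, e)) * 1)"
          using lp_norm_ball_vertex[OF conjugate] nn_e[OF that]
          by (intro sum_mono mult_left_mono) (auto simp: E_def)
        finally show ?thesis by simp
      qed
      then have "(\<Sum>j\<in>{1..k}. lp_norm p (w j)) \<le> (\<Sum>j\<in>{1..k}. \<Sum>e\<in>E. x (Inr (j, e)))"
        by (rule sum_mono)
      also have "\<dots> \<le> 1 / (1 - \<alpha>) * \<epsilon>"
        using rows[of "Inr None"] unfolding row_budget by (auto simp: in_rows rhs_def)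
      finally show "(\<Sum>j\<in>{1..k}. lp_norm p (w j)) \<le> 1 / (1 - \<alpha>) * \<epsilon>" .
    qed
    then show "(\<Sum>v\<in>vars. cost v * x v) \<le> worst_leader \<alpha> \<Q> y"
      unfolding val w_def by (blast intro: le_worst_leader)
  qed
  then obtain u where u: "\<And>r. r \<in> rows \<Longrightarrow> 0 \<le> u r"
    "\<And>v. v \<in> vars \<Longrightarrow> cost v \<le> (\<Sum>r\<in>rows. u r * A r v)"
    "(\<Sum>r\<in>rows. u r * rhs r) \<le> worst_leader \<alpha> \<Q> y"
    by blast
  define s where "s j = u (Inl (Inl j))" for j
  define \<nu> where "\<nu> j = (\<chi> i. u (Inl (Inr (j, i))))" for j
  define lam where "lam = u (Inr None)"
  define t where "t = u (Inr (Some True)) - u (Inr (Some False))"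
  have "leader_constraints q B b k c y \<nu> s lam t"
    unfolding leader_constraints_def
  proof (intro ballI conjI)
    fix j assume j: "j \<in> {1..k}"
    show "0 \<le> \<nu> j" using u(1) j by (auto simp: \<nu>_def less_eq_vec_def in_rows)
    show "0 \<le> s j" using u(1) j by (auto simp: s_def in_rows)
    have *: "(if j = fst i then h else 0) = (if fst i = j then h else (0::real))" for i :: "nat \<times> 'b" and h
      by auto
    \<comment> \<open>The column of \<open>\<gamma> j\<close> is the data constraint of sample
      \<open>j\<close>.\<close>
    have "c j \<bullet> y \<le> (\<Sum>r\<in>rows. u r * A r (Inl j))"
      using u(2)[of "Inl j"] j by (auto simp: in_vars cost_def)
    also have "\<dots> = s j - slack B b (c j) \<bullet> \<nu> j + t"
      using sum_delta_single[OF j finite_atLeastAtMost, of "\<lambda>_. 1"]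
        sum_delta_pair[OF j finite_atLeastAtMost, where E = UNIV and h = "\<lambda>i. - slack B b (c j) $ snd i" and g = "\<lambda>i. u (Inl (Inr i))"]
      by (simp add: sum_rows A_def s_def \<nu>_def t_def inner_vec_def mult.commute * sum_negf eq_commute[of j])
    finally show "c j \<bullet> y - t + slack B b (c j) \<bullet> \<nu> j \<le> s j" by simp
    \<comment> \<open>The columns of \<open>\<eta> (j, e)\<close>, over all vertices
      \<open>e\<close>, together form the norm constraint.\<close>
    have "e \<bullet> (y - transpose B *v \<nu> j) \<le> lam" if e: "e \<in> E" for e
    proof -
      have "e \<bullet> y \<le> (\<Sum>r\<in>rows. u r * A r (Inr (j, e)))"
        using u(2)[of "Inr (j, e)"] j e by (auto simp: in_vars cost_def)
      also have "\<dots> = (B *v e) \<bullet> \<nu> j + lam"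
        using sum_delta_pair[OF j finite_atLeastAtMost, where E = UNIV and h = "\<lambda>i. (B *v e) $ snd i" and g = "\<lambda>i. u (Inl (Inr i))"]
        by (simp cong: if_cong add: sum_rows A_def lam_def \<nu>_def inner_vec_def mult.commute *)
      finally show ?thesis by (simp add: inner_diff_right inner_transpose del: transpose_matrix_vector)
    qed
    then have "lp_norm q (y - transpose B *v \<nu> j) \<le> lam"
      by (simp add: lp_norm_le_iff[OF conjugate] E_def)
    then show "lp_norm q (transpose B *v \<nu> j - y) \<le> lam"
      using lp_norm_minus[OF conjugate_sym[OF conjugate], of "y - transpose B *v \<nu> j"] by simp
  qed
  moreover have "objective s lam t = (\<Sum>r\<in>rows. u r * rhs r)"
    by (simp add: sum_rows rhs_def objective_def s_def lam_def t_def algebra_simps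
        flip: sum_distrib_left sum_divide_distrib)
  ultimately show ?thesis
    using u(3) worst_leader_le_objective by (metis dual_order.antisym)
qed

end

section \<open>Optimality of the follower\<close>

text \<open>Replacing \<open>t\<close> by \<open>- t\<close> turns the negative part into a negated
  positive part. On the reals \<open>Inf\<close> is the negated \<open>Sup\<close> of the negated
  set, so the identity is unconditional.\<close>

lemma risk_follower_eq: "risk_follower \<alpha> y Q = - risk_leader \<alpha> (- y) Q"
proof -
  define g where "g t = t + 1 / (1 - \<alpha>) * (\<integral>c. max (c \<bullet> (- y) - t) 0 \<partial>Q)" for t
  have "min (c \<bullet> y - t) 0 = - max (c \<bullet> (- y) - (- t)) 0" for c t
    by simp
  then have "t + 1 / (1 - \<alpha>) * (\<integral>c. min (c \<bullet> y - t) 0 \<partial>Q) = - g (- t)" for t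
    unfolding g_def by (simp only:) simp
  then have "risk_follower \<alpha> y Q = Sup (range (\<lambda>t. - g (- t)))"
    by (simp add: risk_follower_def)
  also have "range (\<lambda>t. - g (- t)) = uminus ` range g"
    by (auto simp: image_iff) (metis minus_minus)
  also have "Sup (uminus ` range g) = - risk_leader \<alpha> (- y) Q"
    by (simp add: risk_leader_def g_def Inf_real_def)
  finally show ?thesis .
qed

lemma worst_follower_eq: "worst_follower \<alpha> \<Q> y = - worst_leader \<alpha> \<Q> (- y)"
  by (simp add: worst_follower_def worst_leader_def risk_follower_eq Inf_real_def image_image)

context robust_cvar
begin

text \<open>An optimal point of the system for \<open>y'\<close> becomes feasible for
  \<open>y\<close> once every \<open>s j\<close> and \<open>lam\<close> are raised by multiples of
  the distance, and the objective is linear in both.\<close>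

lemma worst_leader_lipschitz: "\<exists>C\<ge>0. \<forall>y y'. worst_leader \<alpha> \<Q> y \<le> worst_leader \<alpha> \<Q> y' + C * norm (y - y')"
proof -
  obtain R where R: "0 < R" "\<And>x. x \<in> S \<Longrightarrow> norm x \<le> R"
    using bounded unfolding bounded_pos by blast
  obtain K where K: "0 \<le> K" "\<And>v :: real ^ 'n. lp_norm q v \<le> K * norm v"
    using lp_norm_le_norm[OF conjugate] by blast
  have "worst_leader \<alpha> \<Q> y \<le> worst_leader \<alpha> \<Q> y' + 1 / (1 - \<alpha>) * (\<epsilon> * K + R) * norm (y - y')" for y y'
  proof -
    obtain \<nu> s lam t where cons: "leader_constraints q B b k c y' \<nu> s lam t"
      and obj: "objective s lam t = worst_leader \<alpha> \<Q> y'"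
      using leader_attained by blast
    define D where "D = norm (y - y')"
    have "leader_constraints q B b k c y \<nu> (\<lambda>j. s j + R * D) (lam + K * D) t"
      unfolding leader_constraints_def
    proof (intro ballI conjI)
      fix j assume j: "j \<in> {1..k}"
      have c: "c j \<bullet> y' - t + slack B b (c j) \<bullet> \<nu> j \<le> s j"
        "lp_norm q (transpose B *v \<nu> j - y') \<le> lam" "0 \<le> \<nu> j" "0 \<le> s j"
        using cons j by (auto simp: leader_constraints_def)
      show "0 \<le> \<nu> j" "0 \<le> s j + R * D" using c R(1) by (simp_all add: D_def)
      have "c j \<bullet> (y - y') \<le> norm (c j) * D" unfolding D_def by (rule norm_cauchy_schwarz)
      also have "\<dots> \<le> R * D" using R(2)[OF data[OF j]] by (intro mult_right_mono) (auto simp: D_def)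
      finally show "c j \<bullet> y - t + slack B b (c j) \<bullet> \<nu> j \<le> s j + R * D"
        using c(1) by (simp add: inner_diff_right)
      have "lp_norm q (transpose B *v \<nu> j - y) \<le>
          lp_norm q (transpose B *v \<nu> j - y') + lp_norm q (y' - y)"
        using lp_norm_triangle[OF conjugate_sym[OF conjugate], of "transpose B *v \<nu> j - y'" "y' - y"] by simp
      also have "lp_norm q (y' - y) \<le> K * D" using K(2)[of "y' - y"] by (simp add: D_def norm_minus_commute)
      finally show "lp_norm q (transpose B *v \<nu> j - y) \<le> lam + K * D" using c(2) by simp
    qed
    then have "worst_leader \<alpha> \<Q> y \<le> objective (\<lambda>j. s j + R * D) (lam + K * D) t"
      by (rule worst_leader_le_objective)
    also have "\<dots> = objective s lam t + 1 / (1 - \<alpha>) * (\<epsilon> * K + R) * D"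
    proof -
      have "1 / real k * (\<Sum>j\<in>{1..k}. s j + R * D) = 1 / real k * (\<Sum>j\<in>{1..k}. s j) + R * D"
        using size by (simp add: sum.distrib distrib_left add_divide_distrib)
      then show ?thesis unfolding objective_def by (simp only:) (simp add: algebra_simps add_divide_distrib)
    qed
    finally show ?thesis by (simp add: obj D_def)
  qed
  moreover have "0 \<le> 1 / (1 - \<alpha>) * (\<epsilon> * K + R)"
    using level radius R(1) K(1) by simp
  ultimately show ?thesis by blast
qed

lemma continuous_on_worst_leader: "continuous_on A (worst_leader \<alpha> \<Q>)"
proof -
  obtain C where C: "0 \<le> C"
    "\<And>y y'. worst_leader \<alpha> \<Q> y \<le> worst_leader \<alpha> \<Q> y' + C * norm (y - y')"
    using worst_leader_lipschitz by blast
  have "C-lipschitz_on A (worst_leader \<alpha> \<Q>)"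
  proof (rule lipschitz_onI[OF _ C(1)])
    fix y y'
    show "dist (worst_leader \<alpha> \<Q> y) (worst_leader \<alpha> \<Q> y') \<le> C * dist y y'"
      using C(2)[of y y'] C(2)[of y' y] by (simp add: dist_norm norm_minus_commute abs_le_iff)
  qed
  then show ?thesis by (rule lipschitz_on_continuous_on)
qed

lemma continuous_on_worst_follower: "continuous_on A (worst_follower \<alpha> \<Q>)"
  unfolding worst_follower_eq[abs_def]
  by (intro continuous_on_minus continuous_on_compose2[OF continuous_on_worst_leader] continuous_on_id) auto

text \<open>Transfers the leader's results by the reflection of \<open>y\<close> and
  \<open>t\<close>; the sign of \<open>lam\<close>, listed only on the left, comes from
  \<open>lam_nonneg\<close>.\<close>

lemma follower_primal_iff:
  "follower_primal_constraints q B b F L f k c x y \<nu> s lam t \<longleftrightarrow>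
    y \<in> follower_set F L f x \<and> leader_constraints q B b k c (- y) \<nu> s lam (- t)"
  using lam_nonneg[of "- y" \<nu> s lam "- t"]
  by (auto simp: follower_primal_constraints_def leader_constraints_def follower_set_def le_diff_eq)

lemma follower_objective:
  "t - 1 / (1 - \<alpha>) * (\<epsilon> * lam + 1 / real k * (\<Sum>j\<in>{1..k}. s j)) = - objective s lam (- t)"
  by (simp add: objective_def)

lemma follower_value_le:
  assumes "follower_primal_constraints q B b F L f k c x y \<nu> s lam t"
  shows "- objective s lam (- t) \<le> worst_follower \<alpha> \<Q> y"
  using worst_leader_le_objective[of "- y" \<nu> s lam "- t"] assms
  unfolding follower_primal_iff worst_follower_eq by simp

lemma follower_attained:
  assumes "y \<in> follower_set F L f x"
  shows "\<exists>\<nu> s lam t. follower_primal_constraints q B b F L f k c x y \<nu> s lam t \<and>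
    - objective s lam (- t) = worst_follower \<alpha> \<Q> y"
proof -
  obtain \<nu> s lam t where "leader_constraints q B b k c (- y) \<nu> s lam t"
    "objective s lam t = worst_leader \<alpha> \<Q> (- y)"
    using leader_attained by blast
  with assms show ?thesis
    by (intro exI[of _ \<nu>] exI[of _ s] exI[of _ lam] exI[of _ "- t"])
      (simp add: follower_primal_iff worst_follower_eq)
qed

text \<open>Each primal constraint is paired with its multiplier and the results are added, first
  for each sample and then over all samples.\<close>

lemma follower_weak_duality:
  assumes primal: "follower_primal_constraints q B b F L f k c x y \<nu> s lam t"
    and dual: "follower_dual_constraints p B b F \<alpha> \<epsilon> k c \<mu>u \<mu>d \<gamma> \<beta>"
  shows "- objective s lam (- t) \<le> (- (L *v x) + f) \<bullet> \<beta>"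
proof -
  have y: "F *v y \<le> f - L *v x" "0 \<le> y" "0 \<le> lam"
    and P: "\<And>j. j \<in> {1..k} \<Longrightarrow> - (c j \<bullet> y) + t + slack B b (c j) \<bullet> \<nu> j \<le> s j"
      "\<And>j. j \<in> {1..k} \<Longrightarrow> lp_norm q (transpose B *v \<nu> j + y) \<le> lam"
      "\<And>j. j \<in> {1..k} \<Longrightarrow> 0 \<le> \<nu> j" "\<And>j. j \<in> {1..k} \<Longrightarrow> 0 \<le> s j"
    using primal by (auto simp: follower_primal_constraints_def)
  define w where "w j = \<mu>u j - \<mu>d j" for j
  have D: "0 \<le> transpose F *v \<beta> - (\<Sum>j\<in>{1..k}. \<gamma> j *\<^sub>R c j) + (\<Sum>j\<in>{1..k}. w j)"
      "(\<Sum>j\<in>{1..k}. lp_norm p (\<mu>u j + \<mu>d j)) \<le> 1 / (1 - \<alpha>) * \<epsilon>"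
      "(\<Sum>j\<in>{1..k}. \<gamma> j) = 1" "0 \<le> \<beta>"
    and Dj: "\<And>j. j \<in> {1..k} \<Longrightarrow> 0 \<le> \<gamma> j *\<^sub>R slack B b (c j) + B *v w j"
      "\<And>j. j \<in> {1..k} \<Longrightarrow> 0 \<le> \<gamma> j" "\<And>j. j \<in> {1..k} \<Longrightarrow> \<gamma> j \<le> 1 / ((1 - \<alpha>) * real k)"
      "\<And>j. j \<in> {1..k} \<Longrightarrow> 0 \<le> \<mu>u j" "\<And>j. j \<in> {1..k} \<Longrightarrow> 0 \<le> \<mu>d j"
    using dual by (auto simp: follower_dual_constraints_def w_def)
  have norm_w: "lp_norm p (w j) \<le> lp_norm p (\<mu>u j + \<mu>d j)" if "j \<in> {1..k}" for j
  proof (rule lp_norm_mono[OF conjugate])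
    fix i
    have "0 \<le> \<mu>u j $ i" "0 \<le> \<mu>d j $ i" using Dj(4,5)[OF that] by (simp_all add: less_eq_vec_def)
    then show "\<bar>w j $ i\<bar> \<le> \<bar>(\<mu>u j + \<mu>d j) $ i\<bar>" by (simp add: w_def)
  qed
  \<comment> \<open>Combines the data constraint times \<open>\<gamma> j\<close>, the dual support
    constraint paired with \<open>\<nu> j\<close>, and Hoelder for \<open>w j\<close>.\<close>
  have per_sample: "\<gamma> j * t - 1 / ((1 - \<alpha>) * real k) * s j - lam * lp_norm p (\<mu>u j + \<mu>d j) \<le>
      \<gamma> j * (c j \<bullet> y) - w j \<bullet> y" if j: "j \<in> {1..k}" for j
  proof -
    have "\<gamma> j * (- (c j \<bullet> y) + t + slack B b (c j) \<bullet> \<nu> j) \<le> \<gamma> j * s j"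
      using P(1)[OF j] Dj(2)[OF j] by (rule mult_left_mono)
    also have "\<dots> \<le> 1 / ((1 - \<alpha>) * real k) * s j"
      using Dj(3)[OF j] P(4)[OF j] by (rule mult_right_mono)
    finally have 1: "\<gamma> j * (- (c j \<bullet> y) + t + slack B b (c j) \<bullet> \<nu> j) \<le> 1 / ((1 - \<alpha>) * real k) * s j" .
    have "0 \<le> (\<gamma> j *\<^sub>R slack B b (c j) + B *v w j) \<bullet> \<nu> j"
      by (intro inner_nonneg_vec Dj(1) P(3) j)
    then have 2: "0 \<le> \<gamma> j * (slack B b (c j) \<bullet> \<nu> j) + w j \<bullet> (transpose B *v \<nu> j)"
      by (simp add: inner_add_left inner_transpose del: transpose_matrix_vector)
    have "w j \<bullet> (transpose B *v \<nu> j + y) \<le> lp_norm p (w j) * lp_norm q (transpose B *v \<nu> j + y)"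
      by (rule lp_norm_hoelder[OF conjugate])
    also have "\<dots> \<le> lp_norm p (\<mu>u j + \<mu>d j) * lam"
      by (intro mult_mono norm_w P j lp_norm_nonneg[OF conjugate] lp_norm_nonneg[OF conjugate_sym[OF conjugate]])
    finally have "w j \<bullet> (transpose B *v \<nu> j) + w j \<bullet> y \<le> lam * lp_norm p (\<mu>u j + \<mu>d j)"
      by (simp add: inner_add_right mult.commute)
    with 1 2 show ?thesis by (simp add: algebra_simps)
  qed
  have "- objective s lam (- t) = t - 1 / ((1 - \<alpha>) * real k) * (\<Sum>j\<in>{1..k}. s j) - lam * (1 / (1 - \<alpha>) * \<epsilon>)"
    by (simp add: objective_def algebra_simps)
  \<comment> \<open>The one \<open>lam\<close> is charged for every sample, so the radius constraint
    must bound the sum of the norms.\<close>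
  also have "\<dots> \<le> (\<Sum>j\<in>{1..k}. \<gamma> j) * t - 1 / ((1 - \<alpha>) * real k) * (\<Sum>j\<in>{1..k}. s j) -
      lam * (\<Sum>j\<in>{1..k}. lp_norm p (\<mu>u j + \<mu>d j))"
    using mult_left_mono[OF D(2) y(3)] D(3) by simp
  also have "\<dots> = (\<Sum>j\<in>{1..k}. \<gamma> j * t - 1 / ((1 - \<alpha>) * real k) * s j - lam * lp_norm p (\<mu>u j + \<mu>d j))"
    unfolding sum_subtractf sum_distrib_left sum_distrib_right ..
  also have "\<dots> \<le> (\<Sum>j\<in>{1..k}. \<gamma> j * (c j \<bullet> y) - w j \<bullet> y)"
    by (rule sum_mono) (rule per_sample)
  also have "\<dots> = ((\<Sum>j\<in>{1..k}. \<gamma> j *\<^sub>R c j) - (\<Sum>j\<in>{1..k}. w j)) \<bullet> y"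
    by (simp add: inner_diff_left inner_sum_left sum_subtractf)
  also have "\<dots> \<le> (transpose F *v \<beta>) \<bullet> y"
    using D(1) y(2) by (intro inner_mono_vec) (simp_all add: algebra_simps)
  also have "\<dots> = (F *v y) \<bullet> \<beta>"
    by (metis inner_commute inner_transpose)
  also have "\<dots> \<le> (- (L *v x) + f) \<bullet> \<beta>"
    using y(1) D(4) by (intro inner_mono_vec) simp_all
  finally show ?thesis .
qed

text \<open>Here \<open>lp_duality\<close> is applied to the primal system with \<open>y\<close>
  among the variables: each of its values is at most the worst-case value of its \<open>y\<close>,
  hence at most \<open>d\<close>.\<close>

lemma follower_dual_attained:
  fixes F :: "real ^ 'n ^ 'f" and L :: "real ^ 'm ^ 'f" and f :: "real ^ 'f" and x :: "real ^ 'm"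
  assumes nonempty: "follower_set F L f x \<noteq> {}"
    and bound: "\<And>y. y \<in> follower_set F L f x \<Longrightarrow> worst_follower \<alpha> \<Q> y \<le> d"
  shows "\<exists>\<mu>u \<mu>d \<gamma> \<beta>. follower_dual_constraints p B b F \<alpha> \<epsilon> k c \<mu>u \<mu>d \<gamma> \<beta> \<and>
    (- (L *v x) + f) \<bullet> \<beta> \<le> d"
proof -
  \<comment> \<open>primal problem in the variables \<open>s j\<close>, \<open>\<nu> j $ i\<close>, \<open>y $ i\<close>, \<open>lam\<close> and the two parts of \<open>t\<close>; the
    multipliers of its rows are \<open>\<beta> $ i\<close>, \<open>\<gamma> j\<close> and \<open>\<eta> j e\<close>\<close>
  define E :: "(real ^ 'n) set" where "E = ball_vertices p"
  have finE: "finite E" by (simp add: E_def finite_ball_vertices)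
  define vars :: "((nat + nat \<times> 'b) + ('n + bool option)) set" where
    "vars = ({1..k} <+> {1..k} \<times> UNIV) <+> UNIV"
  define rows :: "('f + (nat + nat \<times> (real ^ 'n))) set" where
    "rows = UNIV <+> ({1..k} <+> {1..k} \<times> E)"
  \<comment> \<open>Rows in order: the constraints defining the follower's set, the data constraint
    of each sample, and one inequality per sample and vertex for the norm constraint.\<close>
  define A :: "'f + (nat + nat \<times> (real ^ 'n)) \<Rightarrow> (nat + nat \<times> 'b) + ('n + bool option) \<Rightarrow> real" where
    "A r v = (case r of
        Inl i' \<Rightarrow> (case v of Inr (Inl i) \<Rightarrow> F $ i' $ i | _ \<Rightarrow> 0)
      | Inr (Inl j) \<Rightarrow> (case v of
            Inl (Inl j') \<Rightarrow> if j' = j then -1 else 0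
          | Inl (Inr ji) \<Rightarrow> if fst ji = j then slack B b (c j) $ snd ji else 0
          | Inr (Inl i) \<Rightarrow> - c j $ i
          | Inr (Inr None) \<Rightarrow> 0
          | Inr (Inr (Some pos)) \<Rightarrow> if pos then 1 else -1)
      | Inr (Inr je) \<Rightarrow> (case v of
            Inl (Inl j') \<Rightarrow> 0
          | Inl (Inr ji) \<Rightarrow> if fst ji = fst je then (B *v snd je) $ snd ji else 0
          | Inr (Inl i) \<Rightarrow> snd je $ i
          | Inr (Inr None) \<Rightarrow> -1
          | Inr (Inr (Some pos)) \<Rightarrow> 0))" for r v
  define rhs :: "'f + (nat + nat \<times> (real ^ 'n)) \<Rightarrow> real" where
    "rhs r = (case r of Inl i' \<Rightarrow> (- (L *v x) + f) $ i' | Inr _ \<Rightarrow> 0)" for r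
  define cost :: "(nat + nat \<times> 'b) + ('n + bool option) \<Rightarrow> real" where
    "cost v = (case v of
        Inl (Inl j) \<Rightarrow> - (1 / ((1 - \<alpha>) * real k))
      | Inl (Inr _) \<Rightarrow> 0
      | Inr (Inl _) \<Rightarrow> 0
      | Inr (Inr None) \<Rightarrow> - (1 / (1 - \<alpha>) * \<epsilon>)
      | Inr (Inr (Some pos)) \<Rightarrow> if pos then 1 else -1)" for v
  have fin: "finite rows" "finite vars" using finE by (simp_all add: rows_def vars_def)
  have in_vars: "Inl (Inl j) \<in> vars \<longleftrightarrow> j \<in> {1..k}"
    "Inl (Inr ji) \<in> vars \<longleftrightarrow> ji \<in> {1..k} \<times> UNIV" "Inr v \<in> vars" for j ji v
    by (auto simp: vars_def)
  have in_rows: "Inl i' \<in> rows" "Inr (Inl j) \<in> rows \<longleftrightarrow> j \<in> {1..k}"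
    "Inr (Inr je) \<in> rows \<longleftrightarrow> je \<in> {1..k} \<times> E" for i' j je
    by (auto simp: rows_def)
  have sum_vars: "(\<Sum>v\<in>vars. g v) = (\<Sum>j\<in>{1..k}. g (Inl (Inl j))) +
      (\<Sum>ji\<in>{1..k} \<times> UNIV. g (Inl (Inr ji))) + ((\<Sum>i\<in>UNIV. g (Inr (Inl i))) +
      (g (Inr (Inr None)) + (g (Inr (Inr (Some True))) + g (Inr (Inr (Some False))))))"
    for g :: "_ \<Rightarrow> real"
    unfolding vars_def by (simp add: sum.Plus UNIV_option_conv UNIV_bool sum.reindex flip: UNIV_Plus_UNIV)
  have sum_rows: "(\<Sum>r\<in>rows. g r) = (\<Sum>i\<in>UNIV. g (Inl i)) +
      ((\<Sum>j\<in>{1..k}. g (Inr (Inl j))) + (\<Sum>je\<in>{1..k} \<times> E. g (Inr (Inr je))))"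
    for g :: "_ \<Rightarrow> real"
    unfolding rows_def using finE by (simp add: sum.Plus)
  define yv where "yv z = (\<chi> i. z (Inr (Inl i)))"
    for z :: "(nat + nat \<times> 'b) + ('n + bool option) \<Rightarrow> real"
  define \<nu>v where "\<nu>v z j = (\<chi> i. z (Inl (Inr (j, i))))"
    for z :: "(nat + nat \<times> 'b) + ('n + bool option) \<Rightarrow> real" and j
  define sv where "sv z j = z (Inl (Inl j))"
    for z :: "(nat + nat \<times> 'b) + ('n + bool option) \<Rightarrow> real" and j
  define lamv where "lamv z = z (Inr (Inr None))"
    for z :: "(nat + nat \<times> 'b) + ('n + bool option) \<Rightarrow> real"
  define tv where "tv z = z (Inr (Inr (Some True))) - z (Inr (Inr (Some False)))"
    for z :: "(nat + nat \<times> 'b) + ('n + bool option) \<Rightarrow> real"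
  have row_F: "(\<Sum>v\<in>vars. A (Inl i') v * z v) = (F *v yv z) $ i'" for i' z
    by (simp add: sum_vars A_def yv_def matrix_vector_mult_def)
  have row_data: "(\<Sum>v\<in>vars. A (Inr (Inl j)) v * z v) =
      - (c j \<bullet> yv z) + slack B b (c j) \<bullet> \<nu>v z j - sv z j + tv z" if "j \<in> {1..k}" for j z
    using sum_delta_single[OF that finite_atLeastAtMost, of "\<lambda>_. - 1" "sv z"]
      sum_delta_pair[OF that finite_atLeastAtMost,
        where E = UNIV and h = "\<lambda>ji. slack B b (c j) $ snd ji" and g = "\<lambda>ji. z (Inl (Inr ji))"]
    by (simp add: sum_vars A_def yv_def \<nu>v_def sv_def tv_def inner_vec_def sum_negf)
  have row_norm: "(\<Sum>v\<in>vars. A (Inr (Inr (j, e))) v * z v) =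
      e \<bullet> (transpose B *v \<nu>v z j + yv z) - lamv z" if "j \<in> {1..k}" for j e z
    using sum_delta_pair[OF that finite_atLeastAtMost,
        where E = UNIV and h = "\<lambda>ji. (B *v e) $ snd ji" and g = "\<lambda>ji. z (Inl (Inr ji))"]
    by (simp add: sum_vars A_def inner_add_right inner_transpose del: transpose_matrix_vector cong: if_cong)
      (simp add: yv_def \<nu>v_def lamv_def inner_vec_def)
  have val: "(\<Sum>v\<in>vars. cost v * z v) = - objective (sv z) (lamv z) (- tv z)" for z
    by (simp add: sum_vars cost_def objective_def sv_def lamv_def tv_def sum_negf
        sum_divide_distrib[symmetric] algebra_simps)
  have feasible_iff: "(\<forall>r\<in>rows. (\<Sum>v\<in>vars. A r v * z v) \<le> rhs r) \<longleftrightarrow>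
      follower_primal_constraints q B b F L f k c x (yv z) (\<nu>v z) (sv z) (lamv z) (tv z)"
    if nn: "\<And>v. v \<in> vars \<Longrightarrow> 0 \<le> z v" for z
  proof -
    have "0 \<le> yv z" "0 \<le> lamv z" "\<And>j. j \<in> {1..k} \<Longrightarrow> 0 \<le> \<nu>v z j" "\<And>j. j \<in> {1..k} \<Longrightarrow> 0 \<le> sv z j"
      using nn by (simp_all add: yv_def lamv_def \<nu>v_def sv_def less_eq_vec_def in_vars)
    moreover have "(\<forall>r\<in>rows. (\<Sum>v\<in>vars. A r v * z v) \<le> rhs r) \<longleftrightarrow>
        (\<forall>i'. (\<Sum>v\<in>vars. A (Inl i') v * z v) \<le> rhs (Inl i')) \<and>
        (\<forall>j\<in>{1..k}. (\<Sum>v\<in>vars. A (Inr (Inl j)) v * z v) \<le> rhs (Inr (Inl j))) \<and>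
        (\<forall>j\<in>{1..k}. \<forall>e\<in>E. (\<Sum>v\<in>vars. A (Inr (Inr (j, e))) v * z v) \<le> rhs (Inr (Inr (j, e))))"
      unfolding rows_def by (auto simp del: sum.cong)
    ultimately show ?thesis
      by (simp add: row_F row_data row_norm rhs_def follower_primal_constraints_def
          lp_norm_le_iff[OF conjugate] E_def[symmetric] less_eq_vec_def del: transpose_matrix_vector)
        (auto simp: algebra_simps)
  qed
  obtain y0 where y0: "y0 \<in> follower_set F L f x" using nonempty by blast
  then obtain \<nu>0 s0 lam0 t0 where
    primal0: "follower_primal_constraints q B b F L f k c x y0 \<nu>0 s0 lam0 t0"
    using follower_attained by blast
  \<comment> \<open>A feasible point in coordinates, with the free variable \<open>t0\<close> split
    into positive and negative parts.\<close>
  define z0 :: "(nat + nat \<times> 'b) + ('n + bool option) \<Rightarrow> real" where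
    "z0 v = (case v of
        Inl (Inl j) \<Rightarrow> s0 j
      | Inl (Inr ji) \<Rightarrow> \<nu>0 (fst ji) $ snd ji
      | Inr (Inl i) \<Rightarrow> y0 $ i
      | Inr (Inr None) \<Rightarrow> lam0
      | Inr (Inr (Some pos)) \<Rightarrow> if pos then max t0 0 else max (- t0) 0)" for v
  have z0: "yv z0 = y0" "\<nu>v z0 = \<nu>0" "sv z0 = s0" "lamv z0 = lam0" "tv z0 = t0"
    by (simp_all add: yv_def \<nu>v_def sv_def lamv_def tv_def z0_def fun_eq_iff vec_eq_iff)
  have z0_nonneg: "0 \<le> z0 v" if "v \<in> vars" for v
    using that primal0
    by (auto simp: vars_def z0_def follower_primal_constraints_def less_eq_vec_def
        split: sum.split option.split)
  have "\<exists>u. (\<forall>r\<in>rows. 0 \<le> u r) \<and> (\<forall>v\<in>vars. cost v \<le> (\<Sum>r\<in>rows. u r * A r v)) \<and>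
    (\<Sum>r\<in>rows. u r * rhs r) \<le> d"
  proof (rule lp_duality[OF fin z0_nonneg])
    show "(\<Sum>v\<in>vars. A r v * z0 v) \<le> rhs r" if "r \<in> rows" for r
      using feasible_iff[of z0, OF z0_nonneg] primal0 that unfolding z0 by blast
  next
    fix z assume nn: "\<And>v. v \<in> vars \<Longrightarrow> 0 \<le> z v"
      and rows: "\<And>r. r \<in> rows \<Longrightarrow> (\<Sum>v\<in>vars. A r v * z v) \<le> rhs r"
    have primal: "follower_primal_constraints q B b F L f k c x (yv z) (\<nu>v z) (sv z) (lamv z) (tv z)"
      using feasible_iff[of z, OF nn] rows by blast
    then show "(\<Sum>v\<in>vars. cost v * z v) \<le> d"
      unfolding val using bound[of "yv z"] follower_value_le[OF primal]
      by (simp add: follower_primal_iff)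
  qed
  then obtain u where u: "\<And>r. r \<in> rows \<Longrightarrow> 0 \<le> u r"
    "\<And>v. v \<in> vars \<Longrightarrow> cost v \<le> (\<Sum>r\<in>rows. u r * A r v)"
    "(\<Sum>r\<in>rows. u r * rhs r) \<le> d"
    by blast
  define \<beta> where "\<beta> = (\<chi> i. u (Inl i))"
  define \<gamma> where "\<gamma> j = u (Inr (Inl j))" for j
  define \<eta> where "\<eta> j e = u (Inr (Inr (j, e)))" for j e
  define w where "w j = (\<Sum>e\<in>E. \<eta> j e *\<^sub>R e)" for j
  \<comment> \<open>The program yields only the difference \<open>w j\<close>. With its positive and
    negative parts, \<open>\<mu>u j + \<mu>d j\<close> is the entrywise modulus and has no larger
    norm.\<close>
  define \<mu>u :: "nat \<Rightarrow> real ^ 'n" where "\<mu>u j = (\<chi> i. max (w j $ i) 0)" for j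
  define \<mu>d :: "nat \<Rightarrow> real ^ 'n" where "\<mu>d j = (\<chi> i. max (- w j $ i) 0)" for j
  have w: "\<mu>u j - \<mu>d j = w j" for j by (simp add: \<mu>u_def \<mu>d_def vec_eq_iff max_def)
  have \<eta>: "0 \<le> \<eta> j e" if "j \<in> {1..k}" "e \<in> E" for j e
    using u(1) that by (simp add: \<eta>_def in_rows)
  have norm_w: "lp_norm p (\<mu>u j + \<mu>d j) \<le> (\<Sum>e\<in>E. \<eta> j e)" if "j \<in> {1..k}" for j
  proof -
    have "lp_norm p (\<mu>u j + \<mu>d j) \<le> lp_norm p (w j)"
      by (rule lp_norm_mono[OF conjugate]) (simp add: \<mu>u_def \<mu>d_def max_def)
    also have "\<dots> \<le> (\<Sum>e\<in>E. \<eta> j e * lp_norm p e)"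
      unfolding w_def using \<eta>[OF that]
      by (intro order_trans[OF lp_norm_sum[OF conjugate]] sum_mono)
        (simp add: lp_norm_scaleR[OF conjugate])
    also have "\<dots> \<le> (\<Sum>e\<in>E. \<eta> j e * 1)"
      using lp_norm_ball_vertex[OF conjugate] \<eta>[OF that]
      by (intro sum_mono mult_left_mono) (auto simp: E_def)
    finally show ?thesis by simp
  qed
  \<comment> \<open>From here on the columns of \<open>y\<close>, \<open>\<nu>\<close>,
    \<open>s\<close>, \<open>lam\<close> and \<open>t\<close> give the dual constraints; the two
    opposite columns of \<open>t\<close> give an equation.\<close>
  have col_y: "0 \<le> (transpose F *v \<beta> - (\<Sum>j\<in>{1..k}. \<gamma> j *\<^sub>R c j) + (\<Sum>j\<in>{1..k}. w j)) $ i" for i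
    using u(2)[of "Inr (Inl i)"]
    by (simp add: in_vars cost_def sum_rows A_def \<beta>_def \<gamma>_def w_def \<eta>_def sum.cartesian_product'
        matrix_vector_mult_def transpose_def sum_negf mult.commute del: transpose_matrix_vector)
  have col_\<nu>: "0 \<le> (\<gamma> j *\<^sub>R slack B b (c j) + B *v w j) $ i" if j: "j \<in> {1..k}" for i j
  proof -
    have "0 \<le> (\<Sum>r\<in>rows. u r * A r (Inl (Inr (j, i))))"
      using u(2)[of "Inl (Inr (j, i))"] j by (simp add: in_vars cost_def)
    also have "\<dots> = (\<gamma> j *\<^sub>R slack B b (c j) + B *v w j) $ i"
      using sum_delta_single[OF j finite_atLeastAtMost, of "\<lambda>j'. slack B b (c j') $ i" \<gamma>]
        sum_delta_pair[OF j finite_atLeastAtMost,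
        where E = E and h = "\<lambda>je. (B *v snd je) $ i" and g = "\<lambda>je. u (Inr (Inr je))"]
      by (simp add: sum_rows A_def \<gamma>_def w_def \<eta>_def mult.commute eq_commute[of j]
          linear_sum[OF matrix_vector_mul_linear] matrix_vector_mult_scaleR cong: if_cong)
    finally show ?thesis .
  qed
  have col_s: "\<gamma> j \<le> 1 / ((1 - \<alpha>) * real k)" if j: "j \<in> {1..k}" for j
    using u(2)[of "Inl (Inl j)"] j sum_delta_single[OF j finite_atLeastAtMost, of "\<lambda>_. - 1" \<gamma>]
    by (simp add: in_vars cost_def sum_rows A_def \<gamma>_def mult.commute eq_commute[of j] cong: if_cong)
  have col_lam: "(\<Sum>j\<in>{1..k}. \<Sum>e\<in>E. \<eta> j e) \<le> 1 / (1 - \<alpha>) * \<epsilon>"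
    using u(2)[of "Inr (Inr None)"]
    by (simp add: in_vars cost_def sum_rows A_def \<eta>_def sum.cartesian_product' sum_negf)
  have col_t: "(\<Sum>j\<in>{1..k}. \<gamma> j) = 1"
    using u(2)[of "Inr (Inr (Some True))"] u(2)[of "Inr (Inr (Some False))"]
    by (simp add: in_vars cost_def sum_rows A_def \<gamma>_def sum_negf)
  have "follower_dual_constraints p B b F \<alpha> \<epsilon> k c \<mu>u \<mu>d \<gamma> \<beta>"
    unfolding follower_dual_constraints_def w
  proof (intro conjI ballI)
    show "0 \<le> transpose F *v \<beta> - (\<Sum>j\<in>{1..k}. \<gamma> j *\<^sub>R c j) + (\<Sum>j\<in>{1..k}. w j)"
      unfolding less_eq_vec_def zero_index by (intro allI col_y)
    show "0 \<le> \<gamma> j *\<^sub>R slack B b (c j) + B *v w j" if "j \<in> {1..k}" for j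
      unfolding less_eq_vec_def zero_index by (intro allI col_\<nu> that)
    show "0 \<le> \<gamma> j" if "j \<in> {1..k}" for j
      using u(1) that by (simp add: \<gamma>_def in_rows)
    show "0 \<le> \<mu>u j" "0 \<le> \<mu>d j" for j by (simp_all add: \<mu>u_def \<mu>d_def less_eq_vec_def)
    show "(\<Sum>j\<in>{1..k}. lp_norm p (\<mu>u j + \<mu>d j)) \<le> 1 / (1 - \<alpha>) * \<epsilon>"
      by (rule order_trans[OF sum_mono[OF norm_w] col_lam])
    show "0 \<le> \<beta>" using u(1) by (simp add: \<beta>_def in_rows less_eq_vec_def)
  qed (fact col_s col_t)+
  moreover have "(\<Sum>r\<in>rows. u r * rhs r) = (- (L *v x) + f) \<bullet> \<beta>"
    by (simp add: sum_rows rhs_def \<beta>_def inner_vec_def mult.commute)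
  ultimately show ?thesis using u(3) by metis
qed

text \<open>A dual point whose value equals the primal one certifies optimality, since it bounds the
  value of every competitor. Conversely, an optimal value may be taken as the bound in
  \<open>follower_dual_attained\<close>.\<close>

lemma follower_optimal_iff:
  assumes "follower_set F L f x \<noteq> {}"
  shows "is_arg_max (worst_follower \<alpha> \<Q>) (\<lambda>y'. y' \<in> follower_set F L f x) y \<longleftrightarrow>
    (\<exists>\<nu> s \<mu>u \<mu>d \<gamma> lam t \<beta>.
      follower_primal_constraints q B b F L f k c x y \<nu> s lam t \<and>
      follower_dual_constraints p B b F \<alpha> \<epsilon> k c \<mu>u \<mu>d \<gamma> \<beta> \<and>
      (- (L *v x) + f) \<bullet> \<beta> =
        t - 1 / (1 - \<alpha>) * (\<epsilon> * lam + 1 / real k * (\<Sum>j\<in>{1..k}. s j)))" (is "?opt \<longleftrightarrow> ?sys")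
proof
  assume ?opt
  then have y: "y \<in> follower_set F L f x"
    and best: "\<And>y'. y' \<in> follower_set F L f x \<Longrightarrow> worst_follower \<alpha> \<Q> y' \<le> worst_follower \<alpha> \<Q> y"
    by (auto simp: is_arg_max_def not_less)
  obtain \<mu>u \<mu>d \<gamma> \<beta> where dual: "follower_dual_constraints p B b F \<alpha> \<epsilon> k c \<mu>u \<mu>d \<gamma> \<beta>"
    and le: "(- (L *v x) + f) \<bullet> \<beta> \<le> worst_follower \<alpha> \<Q> y"
    using follower_dual_attained[OF assms best] by blast
  obtain \<nu> s lam t where primal: "follower_primal_constraints q B b F L f k c x y \<nu> s lam t"
    and val: "- objective s lam (- t) = worst_follower \<alpha> \<Q> y"
    using follower_attained[OF y] by blast
  have "(- (L *v x) + f) \<bullet> \<beta> = - objective s lam (- t)"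
    using le val follower_weak_duality[OF primal dual] by simp
  with primal dual show ?sys unfolding follower_objective by blast
next
  assume ?sys
  then obtain \<nu> s \<mu>u \<mu>d \<gamma> lam t \<beta> where
    primal: "follower_primal_constraints q B b F L f k c x y \<nu> s lam t" and
    dual: "follower_dual_constraints p B b F \<alpha> \<epsilon> k c \<mu>u \<mu>d \<gamma> \<beta>" and
    eq: "(- (L *v x) + f) \<bullet> \<beta> = - objective s lam (- t)"
    unfolding follower_objective by blast
  have "worst_follower \<alpha> \<Q> y' \<le> worst_follower \<alpha> \<Q> y" if y': "y' \<in> follower_set F L f x" for y'
  proof -
    obtain \<nu>' s' lam' t' where primal': "follower_primal_constraints q B b F L f k c x y' \<nu>' s' lam' t'"
      and val: "- objective s' lam' (- t') = worst_follower \<alpha> \<Q> y'"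
      using follower_attained[OF y'] by blast
    have "worst_follower \<alpha> \<Q> y' \<le> (- (L *v x) + f) \<bullet> \<beta>"
      using follower_weak_duality[OF primal' dual] val by simp
    also have "\<dots> \<le> worst_follower \<alpha> \<Q> y"
      using follower_value_le[OF primal] eq by simp
    finally show ?thesis .
  qed
  moreover have "y \<in> follower_set F L f x" using primal by (simp add: follower_primal_iff)
  ultimately show ?opt by (auto simp: is_arg_max_def not_less)
qed

end

section \<open>Single-level reformulation\<close>

lemma finite_leader_set: "finite (leader_set H h)"
proof (rule finite_subset)
  show "leader_set H h \<subseteq> {x. \<forall>i. x $ i \<in> {0, 1}}" by (auto simp: leader_set_def)
  show "finite {x :: real ^ 'a. \<forall>i. x $ i \<in> {0, 1}}" by (rule finite_vec_components) simp
qed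

lemma closed_follower_set: "closed (follower_set F L f x)"
proof -
  have "closed {y :: real ^ 'a. 0 \<le> y}"
    unfolding less_eq_vec_def zero_index
    by (intro closed_Collect_all closed_Collect_le continuous_intros)
  moreover have "follower_set F L f x = {y. 0 \<le> y} \<inter> support_set F (f - L *v x)"
    by (auto simp: follower_set_def support_set_def le_diff_eq)
  ultimately show ?thesis using closed_support_set by (metis closed_Int)
qed

text \<open>For each \<open>x\<close> the maximisers form a compact set. As \<open>X\<close> is
  finite, their union is compact too, and \<open>h\<close> attains its minimum on it.\<close>

lemma bilevel_minimum_exists:
  fixes g h :: "'a :: topological_space \<Rightarrow> real"
  assumes X: "finite X" "X \<noteq> {}"
    and Y: "\<And>x. x \<in> X \<Longrightarrow> compact (Y x)" "\<And>x. x \<in> X \<Longrightarrow> Y x \<noteq> {}"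
    and cont: "continuous_on UNIV g" "continuous_on UNIV h"
  shows "\<exists>x\<in>X. \<exists>y. is_arg_max g (\<lambda>y'. y' \<in> Y x) y \<and>
    (\<forall>x'\<in>X. \<forall>y'. is_arg_max g (\<lambda>y''. y'' \<in> Y x') y' \<longrightarrow> h y \<le> h y')"
proof -
  define M where "M x = {y. is_arg_max g (\<lambda>y'. y' \<in> Y x) y}" for x
  \<comment> \<open>Written with superlevel sets of \<open>g\<close>, which are closed by
    continuity.\<close>
  have M: "M x = Y x \<inter> (\<Inter>y'\<in>Y x. {y. g y' \<le> g y})" for x
    by (auto simp: M_def is_arg_max_def not_less)
  have "compact (M x)" if "x \<in> X" for x
    unfolding M using Y(1)[OF that]
    by (intro compact_Int_closed closed_INT ballI closed_Collect_le cont continuous_intros)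
  then have compact: "compact (\<Union>x\<in>X. M x)" using X(1) by (intro compact_UN)
  obtain x0 where x0: "x0 \<in> X" using X(2) by blast
  obtain y0 where "y0 \<in> Y x0" "\<forall>y\<in>Y x0. g y \<le> g y0"
    using continuous_attains_sup[OF Y[OF x0] continuous_on_subset[OF cont(1)]] by blast
  then have "y0 \<in> M x0" by (auto simp: M)
  with x0 have "(\<Union>x\<in>X. M x) \<noteq> {}" by blast
  from continuous_attains_inf[OF compact this continuous_on_subset[OF cont(2)]]
  show ?thesis unfolding M_def by blast
qed

theorem theorem1:
  fixes H :: "real ^ 'm ^ 'h" and h :: "real ^ 'h"
    and F :: "real ^ 'n ^ 'f" and L :: "real ^ 'm ^ 'f" and f :: "real ^ 'f"
    and B :: "real ^ 'n ^ 'b" and b :: "real ^ 'b"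
    and p q :: ennreal
    and \<alpha>\<^sub>l \<alpha>\<^sub>f \<epsilon>\<^sub>l \<epsilon>\<^sub>f :: real
    and k\<^sub>l k\<^sub>f :: nat
    and M :: "'w measure" and Qstar :: "(real ^ 'n) measure"
    and C\<^sub>l C\<^sub>f :: "nat \<Rightarrow> 'w \<Rightarrow> real ^ 'n" and \<omega> :: 'w
  defines "X \<equiv> leader_set H h"
    and "Y \<equiv> follower_set F L f"
    and "S \<equiv> support_set B b"
    and "c\<^sub>l \<equiv> (\<lambda>k. C\<^sub>l k \<omega>)"
    and "c\<^sub>f \<equiv> (\<lambda>k. C\<^sub>f k \<omega>)"
  defines "\<Q>\<^sub>l \<equiv> ambiguity_set p S (empirical k\<^sub>l c\<^sub>l) \<epsilon>\<^sub>l"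
    and "\<Q>\<^sub>f \<equiv> ambiguity_set p S (empirical k\<^sub>f c\<^sub>f) \<epsilon>\<^sub>f"
  assumes X: "X \<noteq> {}" "bounded X"
    and Y: "\<And>x. x \<in> X \<Longrightarrow> Y x \<noteq> {}" "\<And>x. x \<in> X \<Longrightarrow> bounded (Y x)"
    and S: "S \<noteq> {}" "compact S"
    and Qstar: "Qstar \<in> distributions_on S"
    and iid: "iid_sample M Qstar k\<^sub>l C\<^sub>l" "iid_sample M Qstar k\<^sub>f C\<^sub>f"
    and realization: "\<omega> \<in> space M"
      "\<And>k. k \<in> {1..k\<^sub>l} \<Longrightarrow> c\<^sub>l k \<in> S" "\<And>k. k \<in> {1..k\<^sub>f} \<Longrightarrow> c\<^sub>f k \<in> S"
    and nested: "k\<^sub>f \<le> k\<^sub>l" "\<And>k. k \<in> {1..k\<^sub>f} \<Longrightarrow> c\<^sub>f k = c\<^sub>l k"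
    and sizes: "1 \<le> k\<^sub>l" "1 \<le> k\<^sub>f"
    and levels: "0 < \<alpha>\<^sub>l" "\<alpha>\<^sub>l < 1" "0 < \<alpha>\<^sub>f" "\<alpha>\<^sub>f < 1"
    and radii: "0 \<le> \<epsilon>\<^sub>l" "0 \<le> \<epsilon>\<^sub>f"
    and p: "p \<in> {1, \<infinity>}" and q: "1 / p + 1 / q = 1"
  shows "\<exists>z. is_minimum (DRI_values X Y \<alpha>\<^sub>l \<Q>\<^sub>l \<alpha>\<^sub>f \<Q>\<^sub>f) z \<and>
    is_minimum
      {t\<^sub>l + 1 / (1 - \<alpha>\<^sub>l) * (\<epsilon>\<^sub>l * lam\<^sub>l + 1 / real k\<^sub>l * (\<Sum>k\<in>{1..k\<^sub>l}. s\<^sub>l k))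
       | x y \<nu>\<^sub>l s\<^sub>l lam\<^sub>l t\<^sub>l \<nu>\<^sub>f s\<^sub>f \<mu>u \<mu>d \<gamma> lam\<^sub>f t\<^sub>f \<beta>.
         x \<in> X \<and>
         leader_constraints q B b k\<^sub>l c\<^sub>l y \<nu>\<^sub>l s\<^sub>l lam\<^sub>l t\<^sub>l \<and>
         follower_primal_constraints q B b F L f k\<^sub>f c\<^sub>f x y \<nu>\<^sub>f s\<^sub>f lam\<^sub>f t\<^sub>f \<and>
         follower_dual_constraints p B b F \<alpha>\<^sub>f \<epsilon>\<^sub>f k\<^sub>f c\<^sub>f \<mu>u \<mu>d \<gamma> \<beta> \<and>
         (- (L *v x) + f) \<bullet> \<beta> =
           t\<^sub>f - 1 / (1 - \<alpha>\<^sub>f) * (\<epsilon>\<^sub>f * lam\<^sub>f + 1 / real k\<^sub>f * (\<Sum>k\<in>{1..k\<^sub>f}. s\<^sub>f k))} z"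
    (is "\<exists>z. is_minimum ?bilevel z \<and> is_minimum ?single z")
proof -
  interpret leader: robust_cvar p q B b k\<^sub>l c\<^sub>l \<alpha>\<^sub>l \<epsilon>\<^sub>l
    using p q S realization sizes levels radii
    by unfold_locales (simp_all add: conjugate_iff S_def compact_imp_bounded)
  interpret follower: robust_cvar p q B b k\<^sub>f c\<^sub>f \<alpha>\<^sub>f \<epsilon>\<^sub>f
    using p q S realization sizes levels radii
    by unfold_locales (simp_all add: conjugate_iff S_def compact_imp_bounded)
  let ?opt = "\<lambda>x y. is_arg_max (worst_follower \<alpha>\<^sub>f \<Q>\<^sub>f) (\<lambda>y'. y' \<in> Y x) y"
  let ?worst = "worst_leader \<alpha>\<^sub>l \<Q>\<^sub>l"
  have Q_eq: "\<Q>\<^sub>l = leader.\<Q>" "\<Q>\<^sub>f = follower.\<Q>"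
    by (simp_all add: \<Q>\<^sub>l_def \<Q>\<^sub>f_def S_def)
  have opt_iff: "?opt x y \<longleftrightarrow> (\<exists>\<nu>\<^sub>f s\<^sub>f \<mu>u \<mu>d \<gamma> lam\<^sub>f t\<^sub>f \<beta>.
      follower_primal_constraints q B b F L f k\<^sub>f c\<^sub>f x y \<nu>\<^sub>f s\<^sub>f lam\<^sub>f t\<^sub>f \<and>
      follower_dual_constraints p B b F \<alpha>\<^sub>f \<epsilon>\<^sub>f k\<^sub>f c\<^sub>f \<mu>u \<mu>d \<gamma> \<beta> \<and>
      (- (L *v x) + f) \<bullet> \<beta> =
        t\<^sub>f - 1 / (1 - \<alpha>\<^sub>f) * (\<epsilon>\<^sub>f * lam\<^sub>f + 1 / real k\<^sub>f * (\<Sum>k\<in>{1..k\<^sub>f}. s\<^sub>f k)))"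
    if "x \<in> X" for x y
    using follower.follower_optimal_iff Y(1)[OF that] unfolding Q_eq Y_def by blast
  \<comment> \<open>The pair obtained here supplies the common value of both minima.\<close>
  have "\<exists>x\<in>X. \<exists>y. ?opt x y \<and> (\<forall>x'\<in>X. \<forall>y'. ?opt x' y' \<longrightarrow> ?worst y \<le> ?worst y')"
  proof (rule bilevel_minimum_exists)
    show "finite X" unfolding X_def by (rule finite_leader_set)
    show "compact (Y x)" if "x \<in> X" for x
      using Y(2)[OF that] closed_follower_set by (auto simp: Y_def compact_eq_bounded_closed)
  qed (use X Y in \<open>auto simp: Q_eq leader.continuous_on_worst_leader
      follower.continuous_on_worst_follower\<close>)
  then obtain x y where x: "x \<in> X" and y: "?opt x y"
    and best: "\<And>x' y'. x' \<in> X \<Longrightarrow> ?opt x' y' \<Longrightarrow> ?worst y \<le> ?worst y'"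
    by blast
  have "is_minimum ?bilevel (?worst y)"
    unfolding is_minimum_def DRI_values_def using x y best by blast
  moreover have "is_minimum ?single (?worst y)"
    unfolding is_minimum_def
  proof (intro conjI ballI)
    obtain \<nu>\<^sub>l s\<^sub>l lam\<^sub>l t\<^sub>l where "leader_constraints q B b k\<^sub>l c\<^sub>l y \<nu>\<^sub>l s\<^sub>l lam\<^sub>l t\<^sub>l"
      and val: "leader.objective s\<^sub>l lam\<^sub>l t\<^sub>l = ?worst y"
      using leader.leader_attained unfolding Q_eq by blast
    \<comment> \<open>The certificates of both players complete the optimal pair to a feasible point
      of the same value.\<close>
    then have "leader.objective s\<^sub>l lam\<^sub>l t\<^sub>l \<in> ?single"
      using x y unfolding opt_iff[OF x] leader.objective_def by blast
    then show "?worst y \<in> ?single" unfolding val .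
  next
    fix v assume "v \<in> ?single"
    then obtain x' y' \<nu>\<^sub>l s\<^sub>l lam\<^sub>l t\<^sub>l where x': "x' \<in> X" and opt': "?opt x' y'"
      and cons: "leader_constraints q B b k\<^sub>l c\<^sub>l y' \<nu>\<^sub>l s\<^sub>l lam\<^sub>l t\<^sub>l"
      and v: "v = leader.objective s\<^sub>l lam\<^sub>l t\<^sub>l"
      using opt_iff unfolding leader.objective_def by blast
    \<comment> \<open>The follower's part of the system makes \<open>y'\<close> admissible for the
      bilevel problem, and the leader's part bounds its risk by \<open>v\<close>.\<close>
    have "?worst y \<le> ?worst y'" by (rule best[OF x' opt'])
    also have "\<dots> \<le> v"
      unfolding v Q_eq by (rule leader.worst_leader_le_objective[OF cons])
    finally show "?worst y \<le> v" .
  qed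
  ultimately show ?thesis by blast
qed

end
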